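(* Let $A$ be a set of integers, each at least $3$, let $\mathcal C_A=\{C_a:a\in A\}$ and let $A_e$ be the set of even elements of $A$. Then, as $n\to\infty$: $ex(n,C_6,\mathcal C_A)=0$ if $6\in A$; $ex(n,C_6,\mathcal C_A)=\Theta(n^2)$ if $6\notin A$, $4\in A$ and $|A_e|\ge 2$; $ex(n,C_6,\mathcal C_A)=\Theta(n^3)$ if $4,6\notin A$ and $A_e\neq\emptyset$, or if $A_e=\{4\}$; $ex(n,C_6,\mathcal C_A)=\Theta(n^6)$ if $A_e=\emptyset$.
   Context: $C_k$ denotes the cycle with $k$ vertices. For a graph $H$ and a family of graphs $\mathcal F$, $ex(n,H,\mathcal F)$ is the maximum number of subgraphs isomorphic to $H$ in an $n$-vertex graph containing no member of $\mathcal F$ as a subgraph. *)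

theory Defs
  imports Main "HOL-Library.Landau_Symbols"
begin

definition graphs_on :: "nat \<Rightarrow> nat set set set" where
  "graphs_on n = {E. \<forall>e\<in>E. \<exists>u v. e = {u, v} \<and> u \<noteq> v \<and> u < n \<and> v < n}"

definition cycle_edges :: "nat \<Rightarrow> nat set set \<Rightarrow> bool" where
  "cycle_edges k C \<longleftrightarrow> 3 \<le> k \<and>
     (\<exists>f :: nat \<Rightarrow> nat. inj_on f {..<k} \<and> C = {{f i, f ((i + 1) mod k)} | i. i < k})"

text \<open>Number of subgraphs of E isomorphic to C_k (a copy of C_k has no isolated
  vertices, so it is determined by its edge set).\<close>
definition num_cycles :: "nat \<Rightarrow> nat set set \<Rightarrow> nat" where
  "num_cycles k E = card {C. C \<subseteq> E \<and> cycle_edges k C}"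

definition contains_cycle :: "nat \<Rightarrow> nat set set \<Rightarrow> bool" where
  "contains_cycle a E \<longleftrightarrow> (\<exists>C. C \<subseteq> E \<and> cycle_edges a C)"

definition ex_cycle :: "nat \<Rightarrow> nat \<Rightarrow> nat set \<Rightarrow> nat" where
  "ex_cycle n k A = Max (num_cycles k ` {E \<in> graphs_on n. \<forall>a\<in>A. \<not> contains_cycle a E})"

end

theory Submission
  imports Defs "HOL-Algebra.Algebraic_Closure_Type" "HOL-Library.Z2"
begin

text \<open>
  Upper bounds. Call a pair of vertices fat if it has more than a constant number of common neighbours.
  In a graph without \<open>C\<^sub>2\<^sub>k\<close> the quadrilaterals with a thin diagonal number \<open>O(n\<^sup>2)\<close>. If those with two fat
  diagonals outnumbered the edges by a large factor, deleting edges in few of them would leave a core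
  in which every edge lies in many, and inside the core any cycle could be lengthened by two, up to
  \<open>C\<^sub>2\<^sub>k\<close>. So the codegrees \<open>f(a, b)\<close> satisfy \<open>\<Sum> f(a, b)\<^sup>2 = O(n\<^sup>2)\<close>. Moreover \<open>\<Sum>\<^sub>b f(a, b) = O(n)\<close> for each \<open>a\<close>,
  as otherwise a path between two neighbours of \<open>a\<close> closes up to a \<open>C\<^sub>2\<^sub>k\<close>. Hence the number of hexagons is at
  most \<open>\<Sum> f(a, b) f(b, c) f(c, a) \<le> \<Sum> f(a, b)\<^sup>2 f(a, c) = O(n\<^sup>3)\<close>; without \<open>C\<^sub>4\<close> the bound is immediate from
  \<open>f \<le> 1\<close>.

  If both \<open>C\<^sub>4\<close> and \<open>C\<^sub>2\<^sub>k\<close> with \<open>k \<ge> 4\<close> are missing, the same argument is run on hexagons, with paths of length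
  three between opposite vertices in place of common neighbours, and with paths of length two, of which
  there are at most \<open>n\<^sup>2\<close>, in place of edges. Cycles in the core can now be lengthened by four, starting from
  lengths six and eight.

  Lower bounds. The graphs are \<open>K\<^sub>n\<^sub>/\<^sub>2\<^sub>,\<^sub>n\<^sub>/\<^sub>2\<close>, \<open>K\<^sub>3\<^sub>,\<^sub>n\<^sub>-\<^sub>3\<close>, the union of internally disjoint paths of length three between
  two vertices, and the incidence graph of points and non-vertical lines of an affine plane.
\<close>

section \<open>Cycles as vertex lists\<close>

definition gpath :: "nat set set \<Rightarrow> nat list \<Rightarrow> bool" where
  "gpath E xs \<longleftrightarrow> distinct xs \<and> successively (\<lambda>u v. {u, v} \<in> E) xs"

text \<open>A cycle of length at least three occurs once for every starting vertex and direction.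
  Counting lists instead of subgraphs changes the counts only by a constant factor.\<close>

definition cyc_lists :: "nat \<Rightarrow> nat set set \<Rightarrow> nat list set" where
  "cyc_lists k E = {xs. length xs = k \<and> gpath E xs \<and> {last xs, hd xs} \<in> E}"

definition cedges :: "nat list \<Rightarrow> nat set set" where
  "cedges xs = {{xs ! i, xs ! ((i + 1) mod length xs)} | i. i < length xs}"

lemma graphs_onD:
  assumes "E \<in> graphs_on n" "{u, v} \<in> E"
  shows "u < n" "v < n" "u \<noteq> v"
proof -
  obtain a b where "{u, v} = {a, b}" "a \<noteq> b" "a < n" "b < n"
    using assms unfolding graphs_on_def by blast
  then show "u < n" "v < n" "u \<noteq> v" by (auto simp: doubleton_eq_iff)
qed

lemma cedges_subset_iff:
  assumes "xs \<noteq> []"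
  shows "cedges xs \<subseteq> E \<longleftrightarrow> successively (\<lambda>u v. {u, v} \<in> E) xs \<and> {last xs, hd xs} \<in> E"
proof -
  let ?k = "length xs"
  have "cedges xs \<subseteq> E \<longleftrightarrow> (\<forall>i<?k. {xs ! i, xs ! ((i + 1) mod ?k)} \<in> E)"
    by (auto simp: cedges_def)
  also have "\<dots> \<longleftrightarrow> (\<forall>i. Suc i < ?k \<longrightarrow> {xs ! i, xs ! Suc i} \<in> E) \<and> {xs ! (?k - 1), xs ! 0} \<in> E"
    (is "?l \<longleftrightarrow> ?r")
  proof
    assume l: ?l
    have "{xs ! i, xs ! Suc i} \<in> E" if "Suc i < ?k" for i
      using l[rule_format, of i] that by simp
    moreover have "{xs ! (?k - 1), xs ! 0} \<in> E"
      using l[rule_format, of "?k - 1"] assms by simp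
    ultimately show ?r by blast
  next
    assume r: ?r
    show ?l
    proof (intro allI impI)
      fix i assume "i < ?k"
      then consider "Suc i < ?k" | "i = ?k - 1" "Suc i = ?k" by linarith
      then show "{xs ! i, xs ! ((i + 1) mod ?k)} \<in> E"
        by cases (use r in auto)
    qed
  qed
  finally show ?thesis
    using assms by (simp add: successively_conv_nth last_conv_nth hd_conv_nth)
qed

lemma cyc_lists_alt:
  assumes "k > 0"
  shows "xs \<in> cyc_lists k E \<longleftrightarrow> length xs = k \<and> distinct xs \<and> cedges xs \<subseteq> E"
  using assms cedges_subset_iff[of xs E] by (auto simp: cyc_lists_def gpath_def)

lemma cycle_edges_iff:
  "cycle_edges k C \<longleftrightarrow> 3 \<le> k \<and> (\<exists>xs. length xs = k \<and> distinct xs \<and> C = cedges xs)"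
proof (cases "3 \<le> k")
  case True
  show ?thesis
  proof
    assume "cycle_edges k C"
    then obtain f where f: "inj_on f {..<k}" "C = {{f i, f ((i + 1) mod k)} | i. i < k}"
      by (auto simp: cycle_edges_def)
    have "C = cedges (map f [0..<k])"
      unfolding f(2) cedges_def using True by (intro Collect_cong ex_cong1) auto
    moreover have "distinct (map f [0..<k])"
      using f(1) by (simp add: distinct_map lessThan_atLeast0)
    ultimately show "3 \<le> k \<and> (\<exists>xs. length xs = k \<and> distinct xs \<and> C = cedges xs)"
      using True by (intro conjI exI[of _ "map f [0..<k]"]) auto
  next
    assume "3 \<le> k \<and> (\<exists>xs. length xs = k \<and> distinct xs \<and> C = cedges xs)"
    then obtain xs where "length xs = k" "distinct xs" "C = cedges xs" by blast
    then show "cycle_edges k C"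
      using True by (auto simp: cycle_edges_def cedges_def inj_on_nth intro!: exI[of _ "(!) xs"])
  qed
qed (simp add: cycle_edges_def)

lemma contains_cycle_iff: "contains_cycle k E \<longleftrightarrow> 3 \<le> k \<and> cyc_lists k E \<noteq> {}"
proof (cases "3 \<le> k")
  case True
  then have "cyc_lists k E = {xs. length xs = k \<and> distinct xs \<and> cedges xs \<subseteq> E}"
    using cyc_lists_alt[of k] by auto
  then show ?thesis using True by (auto simp: contains_cycle_def cycle_edges_iff)
qed (simp add: contains_cycle_def cycle_edges_def)

lemma num_cycles_eq: "3 \<le> k \<Longrightarrow> num_cycles k E = card (cedges ` cyc_lists k E)"
proof -
  assume k: "3 \<le> k"
  then have "cyc_lists k E = {xs. length xs = k \<and> distinct xs \<and> cedges xs \<subseteq> E}"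
    using cyc_lists_alt[of k] by auto
  then show ?thesis using k unfolding num_cycles_def
    by (intro arg_cong[where f = card]) (auto simp: cycle_edges_iff)
qed

lemma cyc_lists_subset:
  assumes "E \<in> graphs_on n" "2 \<le> k"
  shows "cyc_lists k E \<subseteq> {xs. set xs \<subseteq> {..<n} \<and> length xs = k}"
proof clarify
  fix xs assume xs: "xs \<in> cyc_lists k E"
  have "x < n" if "x \<in> set xs" for x
  proof -
    from that obtain i where i: "i < length xs" "x = xs ! i" by (auto simp: in_set_conv_nth)
    then have "{x, xs ! ((i + 1) mod length xs)} \<in> E"
      using xs assms(2) by (auto simp: cyc_lists_alt cedges_def)
    then show "x < n" using graphs_onD(1)[OF assms(1)] by blast
  qed
  then show "set xs \<subseteq> {..<n} \<and> length xs = k" using xs by (auto simp: cyc_lists_def)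
qed

lemma finite_cyc_lists: "E \<in> graphs_on n \<Longrightarrow> 2 \<le> k \<Longrightarrow> finite (cyc_lists k E)"
  using finite_subset[OF cyc_lists_subset finite_lists_length_eq] by blast

lemma card_cyc_lists_le: "E \<in> graphs_on n \<Longrightarrow> 2 \<le> k \<Longrightarrow> card (cyc_lists k E) \<le> n ^ k"
  using card_mono[OF finite_lists_length_eq cyc_lists_subset, of "n" E k]
  by (simp add: card_lists_length_eq)

lemma num_cycles_le: "E \<in> graphs_on n \<Longrightarrow> 3 \<le> k \<Longrightarrow> num_cycles k E \<le> card (cyc_lists k E)"
  by (simp add: num_cycles_eq card_image_le finite_cyc_lists)

text \<open>The union of the edges of a cycle is its vertex set of size \<open>k\<close>, from which
  at most \<open>k ^ k\<close> lists of length \<open>k\<close> can be formed. This crude bound on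
  the fibres of \<open>cedges\<close> suffices for orders of magnitude.\<close>

lemma card_cyc_lists_le_num_cycles:
  assumes "E \<in> graphs_on n" "3 \<le> k"
  shows "card (cyc_lists k E) \<le> k ^ k * num_cycles k E"
proof -
  let ?L = "cyc_lists k E"
  have fin: "finite ?L" using assms by (simp add: finite_cyc_lists)
  have fibre: "card {ys \<in> ?L. cedges ys = C} \<le> k ^ k" if C: "C \<in> cedges ` ?L" for C
  proof -
    have Un: "\<Union> (cedges ys) = set ys" if "length ys = k" for ys
    proof
      show "\<Union> (cedges ys) \<subseteq> set ys"
        using that assms(2) by (auto simp: cedges_def intro!: nth_mem mod_less_divisor)
      show "set ys \<subseteq> \<Union> (cedges ys)"
        unfolding cedges_def set_conv_nth by blast
    qed
    from C obtain xs where xs: "xs \<in> ?L" "C = cedges xs" by blast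
    have "length xs = k" "distinct xs" using xs(1) by (auto simp: cyc_lists_def gpath_def)
    then have card: "card (\<Union> C) = k" "finite (\<Union> C)"
      using Un xs(2) by (auto simp: distinct_card)
    have "{ys \<in> ?L. cedges ys = C} \<subseteq> {ys. set ys \<subseteq> \<Union> C \<and> length ys = k}"
    proof clarify
      fix ys assume "ys \<in> ?L"
      then have "length ys = k" by (simp add: cyc_lists_def)
      then show "set ys \<subseteq> \<Union> (cedges ys) \<and> length ys = k" using Un by simp
    qed
    then have "card {ys \<in> ?L. cedges ys = C} \<le> card {ys. set ys \<subseteq> \<Union> C \<and> length ys = k}"
      by (rule card_mono[OF finite_lists_length_eq[OF card(2)]])
    then show ?thesis
      using card by (simp add: card_lists_length_eq)
  qed
  have "?L = (\<Union>C \<in> cedges ` ?L. {ys \<in> ?L. cedges ys = C})" by auto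
  then have "card ?L = card (\<Union>C \<in> cedges ` ?L. {ys \<in> ?L. cedges ys = C})" by simp
  also have "\<dots> \<le> (\<Sum>C \<in> cedges ` ?L. card {ys \<in> ?L. cedges ys = C})"
    using fin by (intro card_UN_le) auto
  also have "\<dots> \<le> (\<Sum>C \<in> cedges ` ?L. k ^ k)" by (intro sum_mono fibre)
  finally show ?thesis using assms(2) by (simp add: num_cycles_eq mult.commute)
qed

lemma finite_graphs_on: "finite (graphs_on n)"
proof (rule finite_subset)
  show "graphs_on n \<subseteq> Pow (Pow {..<n})" unfolding graphs_on_def by fastforce
qed simp

lemma ex_cycle_le:
  assumes "\<And>E. E \<in> graphs_on n \<Longrightarrow> \<forall>a\<in>A. \<not> contains_cycle a E \<Longrightarrow> num_cycles k E \<le> B"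
  shows "ex_cycle n k A \<le> B"
proof -
  \<comment> \<open>The empty graph belongs to the family, so \<open>Max\<close> is taken over a
    nonempty finite set.\<close>
  have "{} \<in> {E \<in> graphs_on n. \<forall>a\<in>A. \<not> contains_cycle a E}"
    by (auto simp: graphs_on_def contains_cycle_iff cyc_lists_def)
  then show ?thesis
    unfolding ex_cycle_def using assms
    by (subst Max_le_iff) (auto intro: finite_subset[OF _ finite_graphs_on])
qed

lemma num_cycles_le_ex_cycle:
  assumes "E \<in> graphs_on n" "\<forall>a\<in>A. \<not> contains_cycle a E"
  shows "num_cycles k E \<le> ex_cycle n k A"
  unfolding ex_cycle_def
  using assms by (intro Max_ge) (auto intro: finite_subset[OF _ finite_graphs_on])

lemma cyc_lists_rotate1: "0 < k \<Longrightarrow> xs \<in> cyc_lists k E \<Longrightarrow> rotate1 xs \<in> cyc_lists k E"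
  using successively_append_iff[of _ "tl xs" "[hd xs]"]
  by (cases xs; cases "tl xs") (auto simp: cyc_lists_def gpath_def)

lemma cyc_lists_rev: "xs \<in> cyc_lists k E \<Longrightarrow> rev xs \<in> cyc_lists k E"
  by (auto simp: cyc_lists_def gpath_def hd_rev last_rev insert_commute)

lemma length_4_conv: "length h = 4 \<longleftrightarrow> (\<exists>a b c d. h = [a, b, c, d])"
  by (auto simp: numeral_eq_Suc length_Suc_conv)

lemma length_6_conv: "length h = 6 \<longleftrightarrow> (\<exists>a b c d e f. h = [a, b, c, d, e, f])"
  by (auto simp: numeral_eq_Suc length_Suc_conv)

lemma cyc_lists_4_iff:
  "[a, b, c, d] \<in> cyc_lists 4 E \<longleftrightarrow>
    distinct [a, b, c, d] \<and> {a, b} \<in> E \<and> {b, c} \<in> E \<and> {c, d} \<in> E \<and> {d, a} \<in> E"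
  by (auto simp: cyc_lists_def gpath_def)

lemma cyc_lists_6_iff:
  "[a, b, c, d, e, f] \<in> cyc_lists 6 E \<longleftrightarrow>
    distinct [a, b, c, d, e, f] \<and> {a, b} \<in> E \<and> {b, c} \<in> E \<and> {c, d} \<in> E \<and> {d, e} \<in> E \<and> {e, f} \<in> E \<and> {f, a} \<in> E"
  by (auto simp: cyc_lists_def gpath_def)

lemma contains_cycleI:
  "gpath E xs \<Longrightarrow> {last xs, hd xs} \<in> E \<Longrightarrow> length xs = k \<Longrightarrow> 3 \<le> k \<Longrightarrow> contains_cycle k E"
  by (auto simp: contains_cycle_iff cyc_lists_def)

section \<open>Dense cores\<close>

text \<open>Pruning: as long as some \<open>p\<close> in \<open>P\<close> has a fibre with at most
  \<open>M\<close> elements, delete it. This removes at most \<open>M\<close> elements of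
  \<open>H\<close> and one value of \<open>p\<close>, so the left side of the hypothesis drops by at
  least \<open>M\<close> and the strict inequality survives. It also keeps \<open>H\<close> from
  becoming empty.\<close>

lemma dense_core:
  fixes H :: "'h set" and P :: "('h \<Rightarrow> 'o) set"
  assumes "finite H" "finite P" "M * (\<Sum>p\<in>P. card (p ` H)) < card H"
  shows "\<exists>H'\<subseteq>H. H' \<noteq> {} \<and> (\<forall>h\<in>H'. \<forall>p\<in>P. M < card {h'\<in>H'. p h' = p h})"
  using assms(1,3)
proof (induction H rule: finite_psubset_induct)
  case (psubset H)
  show ?case
  proof (cases "\<forall>h\<in>H. \<forall>p\<in>P. M < card {h'\<in>H. p h' = p h}")
    case True
    then show ?thesis using psubset.prems by (intro exI[of _ H]) auto
  next
    case False
    then obtain h p where hp: "h \<in> H" "p \<in> P" "card {h'\<in>H. p h' = p h} \<le> M" by force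
    define S where "S = {h'\<in>H. p h' = p h}"
    have S: "S \<subseteq> H" "h \<in> S" using hp by (auto simp: S_def)
    have "(\<Sum>q\<in>P. card (q ` (H - S))) < (\<Sum>q\<in>P. card (q ` H))"
    proof (rule sum_strict_mono_ex1)
      show "\<forall>q\<in>P. card (q ` (H - S)) \<le> card (q ` H)"
        using psubset.hyps by (auto intro!: card_mono)
      have "p h \<in> p ` H" "p h \<notin> p ` (H - S)" "p ` (H - S) \<subseteq> p ` H" using hp by (auto simp: S_def)
      then have "p ` (H - S) \<subset> p ` H" by blast
      then show "\<exists>q\<in>P. card (q ` (H - S)) < card (q ` H)"
        using hp(2) psubset.hyps by (auto intro!: bexI[of _ p] psubset_card_mono)
    qed (rule assms(2))
    then have "M * (\<Sum>q\<in>P. card (q ` (H - S))) + M \<le> M * (\<Sum>q\<in>P. card (q ` H))"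
      by (metis Suc_leI mult_Suc_right mult_le_mono2 add.commute)
    moreover have "card (H - S) = card H - card S" "card S \<le> card H"
      using S psubset.hyps by (auto simp: card_Diff_subset finite_subset card_mono)
    ultimately have "M * (\<Sum>q\<in>P. card (q ` (H - S))) < card (H - S)"
      using psubset.prems hp(3) unfolding S_def[symmetric] by linarith
    then obtain H' where "H' \<subseteq> H - S" "H' \<noteq> {}" "\<forall>h\<in>H'. \<forall>p\<in>P. M < card {h'\<in>H'. p h' = p h}"
      using psubset.IH[of "H - S"] S by blast
    then show ?thesis by (intro exI[of _ H']) auto
  qed
qed

lemma inj_rotate: "inj (rotate i)"
  unfolding rotate_def by (rule inj_fn[OF inj_rotate1])

text \<open>Apply \<open>dense_core\<close> to the projections \<open>take r (d h)\<close> for all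
  symmetries \<open>d\<close> of a cyclic list. There are at most \<open>2 * k\<close> of them, none
  with more values than \<open>take r\<close>, because \<open>H\<close> is invariant. The core found
  is closed up under the symmetries afterwards, and each \<open>d\<close>, being injective, carries
  large fibres into fibres of \<open>take r\<close>.\<close>

lemma cyclic_core:
  fixes H :: "'a list set"
  assumes fin: "finite H" and len: "\<And>h. h \<in> H \<Longrightarrow> length h = k" and k: "0 < k"
    and rot: "\<And>h. h \<in> H \<Longrightarrow> rotate1 h \<in> H" and rev: "\<And>h. h \<in> H \<Longrightarrow> rev h \<in> H"
    and big: "2 * k * M * card (take r ` H) < card H"
  obtains H' where "H' \<subseteq> H" "H' \<noteq> {}"
    "\<And>h. h \<in> H' \<Longrightarrow> rotate1 h \<in> H'" "\<And>h. h \<in> H' \<Longrightarrow> rev h \<in> H'"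
    "\<And>h. h \<in> H' \<Longrightarrow> M < card {h'\<in>H'. take r h' = take r h}"
proof -
  have rotn: "rotate i h \<in> H" if "h \<in> H" for i h
    using that by (induction i) (auto intro: rot)
  \<comment> \<open>The dihedral group acting on lists of length \<open>k\<close>.\<close>
  define D where "D = (\<lambda>i. rotate i :: 'a list \<Rightarrow> 'a list) ` {..<k} \<union> (\<lambda>i. rotate i \<circ> rev) ` {..<k}"
  define P where "P = (\<lambda>d h. take r (d h)) ` D"
  have "card D \<le> k + k"
    unfolding D_def by (intro order.trans[OF card_Un_le] add_mono order.trans[OF card_image_le]) auto
  then have P: "finite P" "card P \<le> 2 * k"
    unfolding P_def by (auto simp: D_def intro!: order.trans[OF card_image_le])
  have D: "d h \<in> H" if "d \<in> D" "h \<in> H" for d h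
    using that by (auto simp: D_def rotn rev)
  have Dinj: "inj d" if "d \<in> D" for d
    using that inj_rotate by (auto simp: D_def intro!: inj_compose)
  have "(\<Sum>p\<in>P. card (p ` H)) \<le> (\<Sum>p\<in>P. card (take r ` H))"
    by (intro sum_mono card_mono) (auto simp: fin P_def D)
  also have "\<dots> \<le> 2 * k * card (take r ` H)" using P by simp
  finally have "M * (\<Sum>p\<in>P. card (p ` H)) \<le> M * (2 * k * card (take r ` H))" by simp
  also have "\<dots> = 2 * k * M * card (take r ` H)" by (simp only: mult_ac)
  also note big
  finally have "M * (\<Sum>p\<in>P. card (p ` H)) < card H" .
  from dense_core[OF fin P(1) this] obtain H1 where H1: "H1 \<subseteq> H" "H1 \<noteq> {}"
    "\<And>h p. h \<in> H1 \<Longrightarrow> p \<in> P \<Longrightarrow> M < card {h'\<in>H1. p h' = p h}" by blast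
  define H' where "H' = {d h | d h. d \<in> D \<and> h \<in> H1}"
  have rotD: "rotate i h \<in> H'" "rotate i (List.rev h) \<in> H'" if "h \<in> H1" for i h
  proof -
    have "rotate i h = rotate (i mod k) h" "rotate i (List.rev h) = rotate (i mod k) (List.rev h)"
      using len[of h] that H1(1) rotate_conv_mod[of i] by (metis subsetD length_rev)+
    then show "rotate i h \<in> H'" "rotate i (List.rev h) \<in> H'"
      using that k unfolding H'_def D_def by force+
  qed
  have H'_cases: "\<exists>i. g = rotate i h \<or> g = rotate i (List.rev h)" if "g = d h" "d \<in> D" for g d h
    using that by (auto simp: D_def)
  \<comment> \<open>Reversal conjugates a rotation to its inverse, so \<open>H'\<close> is closed
    under reversal.\<close>
  have rr: "List.rev (rotate i h) = rotate (length h - i mod length h) (List.rev h)" for i and h :: "'a list"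
    using rotate_rev[of i "List.rev h"] by simp
  show thesis
  proof (rule that[of H'])
    show "H' \<subseteq> H" using H1(1) D by (auto simp: H'_def)
    show "H' \<noteq> {}" using H1(2) rotD by blast
    fix g assume g: "g \<in> H'"
    then obtain d h where dh: "g = d h" "d \<in> D" "h \<in> H1" by (auto simp: H'_def)
    from H'_cases[OF dh(1,2)] obtain i where i: "g = rotate i h \<or> g = rotate i (List.rev h)" by blast
    show "rotate1 g \<in> H'" using i rotD[OF dh(3), of "Suc i"] by auto
    show "List.rev g \<in> H'"
      using i rotD[OF dh(3)] by (metis rr rev_rev_ident)
    let ?p = "\<lambda>h. take r (d h)"
    have "M < card {h'\<in>H1. ?p h' = ?p h}" using H1(3)[OF dh(3)] dh(2) by (auto simp: P_def)
    also have "\<dots> = card (d ` {h'\<in>H1. ?p h' = ?p h})"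
      by (rule card_image[symmetric], rule inj_on_subset[OF Dinj[OF dh(2)]]) simp
    also have "\<dots> \<le> card {h'\<in>H'. take r h' = take r g}"
      using dh fin finite_subset[OF \<open>H' \<subseteq> H\<close>] by (intro card_mono) (auto simp: H'_def)
    finally show "M < card {h'\<in>H'. take r h' = take r g}" .
  qed
qed

section \<open>Hexagons in graphs without a given even cycle\<close>

definition com :: "nat set set \<Rightarrow> nat \<Rightarrow> nat \<Rightarrow> nat set" where
  "com E a b = {x. {a, x} \<in> E \<and> {b, x} \<in> E}"

lemma com_commute: "com E a b = com E b a"
  by (auto simp: com_def)

lemma com_subset: "E \<in> graphs_on n \<Longrightarrow> com E a b \<subseteq> {..<n}"
  using graphs_onD by (fastforce simp: com_def)

lemma finite_com: "E \<in> graphs_on n \<Longrightarrow> finite (com E a b)"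
  by (rule finite_subset[OF com_subset]) auto

lemma ex_not_in_if_card_less:
  assumes "finite B" "card B < card A"
  obtains x where "x \<in> A" "x \<notin> B"
  using assms by (metis card_mono not_le subsetI)

text \<open>
  The list \<open>xs\<close> is a cycle whose closing edge \<open>a c\<close> lies in many quadrilaterals \<open>a c b d\<close> of the core.
  One of them has \<open>b\<close> or \<open>d\<close> off the cycle, and as the diagonals are fat, \<open>a c\<close> can be replaced by
  \<open>a x b c\<close> or by \<open>a d y c\<close> with fresh \<open>x\<close>, \<open>y\<close>; this path again contains an edge of the quadrilateral.
\<close>

lemma fat_C4_core_extends:
  assumes sub: "H \<subseteq> cyc_lists 4 E" and ne: "H \<noteq> {}"
    and rot: "\<And>h. h \<in> H \<Longrightarrow> rotate1 h \<in> H" and rev: "\<And>h. h \<in> H \<Longrightarrow> rev h \<in> H"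
    and deg: "\<And>h. h \<in> H \<Longrightarrow> 4 * k\<^sup>2 < card {h'\<in>H. take 2 h' = take 2 h}"
    and fat: "\<And>a c b d. [a, c, b, d] \<in> H \<Longrightarrow> 2 * k < card (com E a b)"
  shows "2 \<le> l \<Longrightarrow> l \<le> k \<Longrightarrow>
    \<exists>xs. gpath E xs \<and> length xs = 2 * l \<and> (\<exists>b d. [last xs, hd xs, b, d] \<in> H)"
proof (induction l rule: nat_induct_at_least)
  case base
  from ne sub obtain h where h: "h \<in> H" "length h = 4" by (auto simp: cyc_lists_def)
  then obtain a c b d where abcd: "[a, c, b, d] \<in> H" by (auto simp: length_4_conv)
  \<comment> \<open>The quadrilateral itself, read from \<open>c\<close> to \<open>a\<close>, is the
    starting path with closing edge \<open>a c\<close>.\<close>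
  then have "rotate1 [a, c, b, d] \<in> cyc_lists 4 E" using rot sub by blast
  then have "gpath E [c, b, d, a]" by (simp add: cyc_lists_def)
  with abcd show ?case by (intro exI[of _ "[c, b, d, a]"]) auto
next
  case (Suc l)
  then obtain xs b0 d0 where xs: "gpath E xs" "length xs = 2 * l" "[last xs, hd xs, b0, d0] \<in> H" by auto
  define a c where "a = last xs" and "c = hd xs"
  have ne': "xs \<noteq> []" using xs(2) Suc by auto
  have csub: "card (set xs) \<le> 2 * l" using xs(2) card_length by metis
  \<comment> \<open>Otherwise every quadrilateral of the core on \<open>a c\<close> has both
    remaining vertices on the path, which leaves at most \<open>4 * k\<^sup>2\<close> choices and
    contradicts \<open>deg\<close>.\<close>
  have "\<exists>b d. [a, c, b, d] \<in> H \<and> (b \<notin> set xs \<or> d \<notin> set xs)"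
  proof (rule ccontr)
    assume neg: "\<not> ?thesis"
    let ?G = "{h'\<in>H. take 2 h' = [a, c]}"
    have "?G \<subseteq> (\<lambda>(b, d). [a, c, b, d]) ` (set xs \<times> set xs)"
    proof
      fix h assume h: "h \<in> ?G"
      then have "length h = 4" using sub by (auto simp: cyc_lists_def)
      then obtain a' c' b d where "h = [a', c', b, d]" unfolding length_4_conv by blast
      then have "h = [a, c, b, d]" using h by auto
      then show "h \<in> (\<lambda>(b, d). [a, c, b, d]) ` (set xs \<times> set xs)" using neg h by auto
    qed
    then have "card ?G \<le> card ((\<lambda>(b, d). [a, c, b, d]) ` (set xs \<times> set xs))"
      by (intro card_mono) auto
    also have "\<dots> \<le> card (set xs \<times> set xs)" by (intro card_image_le) auto
    also have "\<dots> \<le> (2 * l) * (2 * l)" unfolding card_cartesian_product by (intro mult_le_mono csub)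
    also have "\<dots> \<le> 4 * k\<^sup>2" using Suc.prems by (simp add: power2_eq_square mult_le_mono)
    finally show False using deg[OF xs(3)] by (simp add: a_def c_def numeral_eq_Suc)
  qed
  then obtain b d where bd: "[a, c, b, d] \<in> H" "b \<notin> set xs \<or> d \<notin> set xs" by blast
  have edges: "distinct [a, c, b, d]" "{a, c} \<in> E" "{c, b} \<in> E" "{b, d} \<in> E" "{d, a} \<in> E"
    using bd(1) sub cyc_lists_4_iff[of a c b d E] by auto
  \<comment> \<open>With \<open>l < k\<close>, the path and two further vertices number at most
    \<open>2 * k\<close>, fewer than the common neighbours along a fat diagonal.\<close>
  have small: "card (insert b (insert d (set xs))) \<le> 2 * k"
    using csub Suc.prems by (simp add: card_insert_if)
  from bd(2) show ?case
  proof
    assume b: "b \<notin> set xs"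
    have "2 * k < card (com E a b)" using fat bd(1) by blast
    with small obtain x where x: "x \<in> com E a b" "x \<notin> insert b (insert d (set xs))"
      using ex_not_in_if_card_less[of "insert b (insert d (set xs))" "com E a b"] by auto
    \<comment> \<open>The new path ends in \<open>b\<close> and still starts in \<open>c\<close>, so
      its closing edge is \<open>b c\<close>; the same quadrilateral read as \<open>b c a d\<close>
      contains it in the required position.\<close>
    have "rotate1 (rev [a, c, b, d]) \<in> H" using rot rev bd(1) by blast
    then have "[b, c, a, d] \<in> H" by simp
    moreover have "gpath E (xs @ [x, b])"
      using xs(1) x b ne' by (auto simp: gpath_def successively_append_iff com_def a_def insert_commute)
    ultimately show ?thesis
      using xs(2) ne' by (intro exI[of _ "xs @ [x, b]"]) (auto simp: c_def)
  next
    assume d: "d \<notin> set xs"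
    have "rotate1 [a, c, b, d] \<in> H" using rot bd(1) by blast
    then have "2 * k < card (com E c d)" using fat by simp
    with small obtain y where y: "y \<in> com E c d" "y \<notin> insert b (insert d (set xs))"
      using ex_not_in_if_card_less[of "insert b (insert d (set xs))" "com E c d"] by auto
    have "rotate1 (rotate1 (rotate1 (rev [a, c, b, d]))) \<in> H" using rot rev bd(1) by blast
    then have "[a, d, b, c] \<in> H" by simp
    moreover have "gpath E (d # y # xs)"
      using xs(1) y d ne' by (auto simp: gpath_def successively_Cons com_def c_def insert_commute)
    ultimately show ?thesis
      using xs(2) ne' by (intro exI[of _ "d # y # xs"]) (auto simp: a_def)
  qed
qed

text \<open>The constant is 4 + 4 + 32. A thin diagonal leaves \<open>n\<^sup>2\<close> choices for
  its ends and \<open>(2 * k)\<^sup>2\<close> for the other two vertices, for either diagonal. The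
  term 32 is \<open>2 * 4 * 4\<close>, the threshold of \<open>cyclic_core\<close> for lists of
  length four with \<open>M = 4 * k\<^sup>2\<close>; there \<open>take 2\<close> reads off ordered
  edges, at most \<open>n\<^sup>2\<close> in number.\<close>

lemma card_C4_lists_le:
  assumes E: "E \<in> graphs_on n" and free: "\<not> contains_cycle (2 * k) E" and k: "2 \<le> k"
  shows "card (cyc_lists 4 E) \<le> 40 * k\<^sup>2 * n\<^sup>2"
proof -
  let ?L = "cyc_lists 4 E"
  have finL: "finite ?L" using E by (simp add: finite_cyc_lists)
  define T where "T = {h\<in>?L. card (com E (h ! 0) (h ! 2)) \<le> 2 * k}"
  define T' where "T' = {h\<in>?L. card (com E (h ! 1) (h ! 3)) \<le> 2 * k}"
  define H where "H = {h\<in>?L. 2 * k < card (com E (h ! 0) (h ! 2)) \<and> 2 * k < card (com E (h ! 1) (h ! 3))}"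
  have fin: "finite T" "finite T'" "finite H" using finL by (auto simp: T_def T'_def H_def)
  have L: "?L = T \<union> T' \<union> H" by (auto simp: T_def T'_def H_def)
  have "T \<subseteq> (\<lambda>((a, b), (x, y)). [a, x, b, y]) `
      (SIGMA p:{p\<in>{..<n} \<times> {..<n}. card (com E (fst p) (snd p)) \<le> 2 * k}. com E (fst p) (snd p) \<times> com E (fst p) (snd p))"
    (is "_ \<subseteq> ?f ` ?S")
  proof
    fix h assume h: "h \<in> T"
    then have "length h = 4" by (auto simp: T_def cyc_lists_def)
    then obtain a x b y where hh: "h = [a, x, b, y]" by (auto simp: length_4_conv)
    have e: "{a, x} \<in> E" "{x, b} \<in> E" "{b, y} \<in> E" "{y, a} \<in> E"
      using h hh by (auto simp: T_def cyc_lists_4_iff)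
    then have "((a, b), (x, y)) \<in> ?S"
      using h hh graphs_onD[OF E] by (auto simp: T_def com_def insert_commute)
    then show "h \<in> ?f ` ?S" by (rule rev_image_eqI) (simp add: hh)
  qed
  moreover have finS: "finite ?S" using finite_com[OF E] by (auto intro!: finite_SigmaI)
  ultimately have "card T \<le> card ?S" by (meson card_image_le card_mono finite_imageI order_trans)
  also have "\<dots> = (\<Sum>p\<in>{p\<in>{..<n} \<times> {..<n}. card (com E (fst p) (snd p)) \<le> 2 * k}. card (com E (fst p) (snd p)) * card (com E (fst p) (snd p)))"
    using finite_com[OF E] by (subst card_SigmaI) (auto simp: card_cartesian_product)
  also have "\<dots> \<le> (\<Sum>p\<in>{p\<in>{..<n} \<times> {..<n}. card (com E (fst p) (snd p)) \<le> 2 * k}. (2 * k) * (2 * k))"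
    by (intro sum_mono mult_le_mono) auto
  also have "\<dots> \<le> (\<Sum>p\<in>{..<n} \<times> {..<n}. (2 * k) * (2 * k))"
    by (intro sum_mono2) auto
  also have "\<dots> = 4 * k\<^sup>2 * n\<^sup>2" by (simp add: card_cartesian_product power2_eq_square)
  finally have T: "card T \<le> 4 * k\<^sup>2 * n\<^sup>2" .
  have "rotate1 ` T' \<subseteq> T"
  proof
    fix g assume "g \<in> rotate1 ` T'"
    then obtain h where h: "h \<in> T'" "g = rotate1 h" by blast
    then have "length h = 4" by (auto simp: T'_def cyc_lists_def)
    then obtain a x b y where hh: "h = [a, x, b, y]" by (auto simp: length_4_conv)
    then show "g \<in> T" using h cyc_lists_rotate1[of 4 h E] by (auto simp: T_def T'_def)
  qed
  then have "card (rotate1 ` T') \<le> card T" by (intro card_mono fin)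
  then have T': "card T' \<le> 4 * k\<^sup>2 * n\<^sup>2"
    using T by (simp add: card_image inj_on_subset[OF inj_rotate1])
  have H: "card H \<le> 32 * k\<^sup>2 * n\<^sup>2"
  proof (rule ccontr)
    assume neg: "\<not> ?thesis"
    have sub: "H \<subseteq> {xs. set xs \<subseteq> {..<n} \<and> length xs = 4}"
      using cyc_lists_subset[OF E, of 4] by (auto simp: H_def)
    then have "take 2 ` H \<subseteq> {xs. set xs \<subseteq> {..<n} \<and> length xs = 2}"
      using set_take_subset by fastforce
    then have "card (take 2 ` H) \<le> n\<^sup>2"
      using card_mono[OF finite_lists_length_eq[of "{..<n}" 2]] by (fastforce simp: card_lists_length_eq)
    then have "2 * 4 * (4 * k\<^sup>2) * card (take 2 ` H) \<le> 2 * 4 * (4 * k\<^sup>2) * n\<^sup>2"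
      by (intro mult_le_mono2)
    also have "\<dots> < card H" using neg by simp
    finally have big: "2 * 4 * (4 * k\<^sup>2) * card (take 2 ` H) < card H" .
    have Hrot: "rotate1 h \<in> H" if "h \<in> H" for h
    proof -
      have "length h = 4" using that by (auto simp: H_def cyc_lists_def)
      then obtain a x b y where hh: "h = [a, x, b, y]" by (auto simp: length_4_conv)
      then show ?thesis using that cyc_lists_rotate1[of 4 h E] com_commute by (auto simp: H_def)
    qed
    have Hrev: "rev h \<in> H" if "h \<in> H" for h
    proof -
      have "length h = 4" using that by (auto simp: H_def cyc_lists_def)
      then obtain a x b y where hh: "h = [a, x, b, y]" by (auto simp: length_4_conv)
      then show ?thesis using that cyc_lists_rev[of h 4 E] com_commute by (auto simp: H_def)
    qed
    obtain H' where H': "H' \<subseteq> H" "H' \<noteq> {}"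
      "\<And>h. h \<in> H' \<Longrightarrow> rotate1 h \<in> H'" "\<And>h. h \<in> H' \<Longrightarrow> rev h \<in> H'"
      "\<And>h. h \<in> H' \<Longrightarrow> 4 * k\<^sup>2 < card {h'\<in>H'. take 2 h' = take 2 h}"
      using cyclic_core[OF fin(3) _ _ Hrot Hrev big] by (auto simp: H_def cyc_lists_def)
    have sub: "H' \<subseteq> ?L" using H'(1) by (auto simp: H_def)
    have "\<exists>xs. gpath E xs \<and> length xs = 2 * k \<and> (\<exists>b d. [last xs, hd xs, b, d] \<in> H')"
      by (rule fat_C4_core_extends[OF sub H'(2-5) _ k]) (use H'(1) in \<open>auto simp: H_def\<close>)
    then obtain xs b d where xs: "gpath E xs" "length xs = 2 * k" "[last xs, hd xs, b, d] \<in> H'" by blast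
    then have "{last xs, hd xs} \<in> E" using sub cyc_lists_4_iff by blast
    then show False using contains_cycleI[OF xs(1)] xs(2) free k by auto
  qed
  have "card ?L \<le> card T + card T' + card H"
    unfolding L using card_Un_le[of "T \<union> T'" H] card_Un_le[of T T'] by linarith
  then show ?thesis using T T' H by linarith
qed

text \<open>
  Many walks \<open>a c b\<close> would give a path with \<open>2 k - 1\<close> vertices that alternates between neighbours of \<open>a\<close>
  and arbitrary vertices and has both ends adjacent to \<open>a\<close>.
\<close>

lemma card_two_walks_le:
  assumes E: "E \<in> graphs_on n" and free: "\<not> contains_cycle (2 * k) E" and k: "2 \<le> k"
  shows "card {(c, b). {a, c} \<in> E \<and> {c, b} \<in> E \<and> b \<noteq> a} \<le> 4 * k * n"
proof (rule ccontr)
  define H where "H = {(c, b). {a, c} \<in> E \<and> {c, b} \<in> E \<and> b \<noteq> a}"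
  assume "\<not> card {(c, b). {a, c} \<in> E \<and> {c, b} \<in> E \<and> b \<noteq> a} \<le> 4 * k * n"
  then have neg: "4 * k * n < card H" by (simp add: H_def)
  have sub: "H \<subseteq> {..<n} \<times> {..<n}" using graphs_onD[OF E] by (auto simp: H_def)
  then have fin: "finite H" by (rule finite_subset) simp
  have "fst ` H \<subseteq> {..<n}" "snd ` H \<subseteq> {..<n}" using sub by auto
  then have im: "card (fst ` H) \<le> n" "card (snd ` H) \<le> n"
    using card_mono[of "{..<n}"] by fastforce+
  \<comment> \<open>The two projections have at most \<open>n\<close> values each, so
    \<open>dense_core\<close> with \<open>M = 2 * k\<close> needs more than \<open>4 * k * n\<close>
    walks.\<close>
  have "(\<Sum>p\<in>{fst, snd}. card (p ` H)) \<le> (\<Sum>p\<in>{fst, snd :: nat \<times> nat \<Rightarrow> nat}. n)"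
    using im by (intro sum_mono) auto
  also have "\<dots> \<le> 2 * n" by (auto simp: card_insert_if)
  finally have "2 * k * (\<Sum>p\<in>{fst, snd}. card (p ` H)) \<le> 2 * k * (2 * n)" by (rule mult_le_mono2)
  with neg have big: "2 * k * (\<Sum>p\<in>{fst, snd}. card (p ` H)) < card H" by linarith
  obtain H' where H': "H' \<subseteq> H" "H' \<noteq> {}"
    "\<And>h p. h \<in> H' \<Longrightarrow> p \<in> {fst, snd} \<Longrightarrow> 2 * k < card {h'\<in>H'. p h' = p h}"
    using dense_core[OF fin _ big] by blast
  \<comment> \<open>In the core, one can move from \<open>c\<close> to a new \<open>b\<close>, and
    by \<open>left\<close> from \<open>b\<close> to a new neighbour \<open>c\<close> of
    \<open>a\<close>, avoiding any \<open>2 * k\<close> vertices.\<close>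
  have right: "\<exists>b. (c, b) \<in> H' \<and> b \<notin> B" if "(c, b0) \<in> H'" "finite B" "card B \<le> 2 * k" for c b0 B
  proof -
    have "card (Pair c ` B) < card {h'\<in>H'. fst h' = c}"
      using H'(3)[OF that(1), of fst] that(2,3) card_image_le[of B "Pair c"] by auto
    with that(2) obtain h where "h \<in> {h'\<in>H'. fst h' = c}" "h \<notin> Pair c ` B"
      using ex_not_in_if_card_less[of "Pair c ` B"] by blast
    then show ?thesis by (cases h) auto
  qed
  have left: "\<exists>c. (c, b) \<in> H' \<and> c \<notin> B" if "(c0, b) \<in> H'" "finite B" "card B \<le> 2 * k" for c0 b B
  proof -
    have "card ((\<lambda>c. (c, b)) ` B) < card {h'\<in>H'. snd h' = b}"
      using H'(3)[OF that(1), of snd] that(2,3) card_image_le[of B "\<lambda>c. (c, b)"] by auto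
    with that(2) obtain h where "h \<in> {h'\<in>H'. snd h' = b}" "h \<notin> (\<lambda>c. (c, b)) ` B"
      using ex_not_in_if_card_less[of "(\<lambda>c. (c, b)) ` B"] by blast
    then show ?thesis by (cases h) auto
  qed
  \<comment> \<open>The path consists of \<open>l\<close> neighbours of \<open>a\<close> with
    \<open>l - 1\<close> other vertices between them; the last neighbour still belongs to the
    core.\<close>
  have path: "1 \<le> l \<Longrightarrow> l \<le> k \<Longrightarrow> \<exists>xs. gpath E xs \<and> length xs = 2 * l - 1 \<and> a \<notin> set xs \<and> {a, hd xs} \<in> E \<and>
      (\<exists>b. (last xs, b) \<in> H')" for l
  proof (induction l rule: nat_induct_at_least)
    case base
    from H'(2) obtain c b where cb: "(c, b) \<in> H'" by auto
    then have e: "{a, c} \<in> E" using H'(1) by (auto simp: H_def)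
    have "a \<noteq> c" using graphs_onD(3)[OF E e] .
    with e show ?case using cb by (intro exI[of _ "[c]"]) (auto simp: gpath_def)
  next
    case (Suc l)
    then obtain xs b0 where xs: "gpath E xs" "length xs = 2 * l - 1" "a \<notin> set xs" "{a, hd xs} \<in> E"
      "(last xs, b0) \<in> H'" by auto
    have ne: "xs \<noteq> []" using xs(2) Suc.hyps by auto
    have "card (set xs) \<le> 2 * k" using card_length[of xs] xs(2) Suc.prems by linarith
    then obtain b where b: "(last xs, b) \<in> H'" "b \<notin> set xs" using right[OF xs(5)] by blast
    obtain c where c: "(c, b) \<in> H'" "c \<notin> set xs"
      using left[OF b(1)] \<open>card (set xs) \<le> 2 * k\<close> by blast
    have e: "{last xs, b} \<in> E" "b \<noteq> a" "{c, b} \<in> E" "{a, c} \<in> E" using b(1) c(1) H'(1) by (auto simp: H_def)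
    have "c \<noteq> b" "a \<noteq> c" using graphs_onD(3)[OF E e(3)] graphs_onD(3)[OF E e(4)] by auto
    then have "gpath E (xs @ [b, c])"
      using xs(1) b(2) c(2) ne e by (auto simp: gpath_def successively_append_iff insert_commute)
    then show ?case
      using xs ne e \<open>a \<noteq> c\<close> c(1) Suc.hyps by (intro exI[of _ "xs @ [b, c]"]) auto
  qed
  from path[of k] k obtain xs b where xs: "gpath E xs" "length xs = 2 * k - 1" "a \<notin> set xs" "{a, hd xs} \<in> E"
      "(last xs, b) \<in> H'" by auto
  have ne: "xs \<noteq> []" using xs(2) k by auto
  have "{last xs, a} \<in> E" using xs(5) H'(1) by (auto simp: H_def insert_commute)
  then have "contains_cycle (2 * k) E"
    using xs ne k by (intro contains_cycleI[of E "a # xs"]) (auto simp: gpath_def successively_Cons)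
  with free show False by simp
qed

section \<open>Codegree sums and the cubic bound\<close>

definition codeg :: "nat set set \<Rightarrow> nat \<Rightarrow> nat \<Rightarrow> nat" where
  "codeg E a b = (if a = b then 0 else card (com E a b))"

lemma codeg_commute: "codeg E a b = codeg E b a"
  by (simp add: codeg_def com_commute)

text \<open>A hexagon \<open>a x b y c z\<close> consists of its alternate vertices
  \<open>a\<close>, \<open>b\<close>, \<open>c\<close> and one common neighbour for each two of
  them.\<close>

lemma card_C6_lists_le_sum_codeg:
  assumes E: "E \<in> graphs_on n"
  shows "card (cyc_lists 6 E) \<le> (\<Sum>a<n. \<Sum>b<n. \<Sum>c<n. codeg E a b * codeg E b c * codeg E c a)"
proof -
  define I where "I = {(a, b, c) \<in> {..<n} \<times> {..<n} \<times> {..<n}. a \<noteq> b \<and> b \<noteq> c \<and> c \<noteq> a}"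
  have finI: "finite I" by (rule finite_subset[of _ "{..<n} \<times> {..<n} \<times> {..<n}"]) (auto simp: I_def)
  let ?S = "SIGMA p:I. (case p of (a, b, c) \<Rightarrow> com E a b \<times> com E b c \<times> com E c a)"
  let ?f = "\<lambda>((a, b, c), (x, y, z)). [a, x, b, y, c, z :: nat]"
  have fin: "finite ?S"
    using finite_com[OF E] finI by (intro finite_SigmaI) (auto split: prod.splits)
  have "cyc_lists 6 E \<subseteq> ?f ` ?S"
  proof
    fix h assume h: "h \<in> cyc_lists 6 E"
    then have "length h = 6" by (auto simp: cyc_lists_def)
    then obtain a x b y c z where hh: "h = [a, x, b, y, c, z]" unfolding length_6_conv by blast
    have e: "{a, x} \<in> E" "{x, b} \<in> E" "{b, y} \<in> E" "{y, c} \<in> E" "{c, z} \<in> E" "{z, a} \<in> E"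
      "a \<noteq> b" "b \<noteq> c" "c \<noteq> a"
      using h hh by (auto simp: cyc_lists_def gpath_def)
    then have "((a, b, c), (x, y, z)) \<in> ?S"
      using graphs_onD[OF E] by (auto simp: I_def com_def insert_commute)
    then show "h \<in> ?f ` ?S" by (rule rev_image_eqI) (simp add: hh)
  qed
  with fin have "card (cyc_lists 6 E) \<le> card ?S"
    by (meson card_image_le card_mono finite_imageI order_trans)
  \<comment> \<open>On \<open>I\<close> the three vertices are distinct, so each
    \<open>codeg\<close> is a number of common neighbours; its value 0 on the diagonal, in place of
    a degree, keeps the later sums small.\<close>
  also have "\<dots> = (\<Sum>p\<in>I. (case p of (a, b, c) \<Rightarrow> codeg E a b * codeg E b c * codeg E c a))"
    using finite_com[OF E] finI
    by (subst card_SigmaI) (auto simp: I_def card_cartesian_product codeg_def intro!: sum.cong)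
  also have "\<dots> \<le> (\<Sum>p\<in>{..<n} \<times> {..<n} \<times> {..<n}.
      (case p of (a, b, c) \<Rightarrow> codeg E a b * codeg E b c * codeg E c a))"
    by (intro sum_mono2) (auto simp: I_def)
  also have "\<dots> = (\<Sum>a<n. \<Sum>b<n. \<Sum>c<n. codeg E a b * codeg E b c * codeg E c a)"
    by (simp add: sum.cartesian_product)
  finally show ?thesis .
qed

lemma com_unique_if_C4_free:
  assumes E: "E \<in> graphs_on n" and free: "\<not> contains_cycle 4 E"
    and e: "a \<noteq> b" "{a, x} \<in> E" "{b, x} \<in> E" "{a, y} \<in> E" "{b, y} \<in> E"
  shows "x = y"
proof (rule ccontr)
  assume "x \<noteq> y"
  then have "[a, x, b, y] \<in> cyc_lists 4 E"
    using e graphs_onD(3)[OF E] by (auto simp: cyc_lists_4_iff insert_commute)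
  then show False using free by (auto simp: contains_cycle_iff)
qed

lemma codeg_le_1_if_C4_free:
  assumes "E \<in> graphs_on n" "\<not> contains_cycle 4 E"
  shows "codeg E a b \<le> 1"
proof -
  have "x = y" if "a \<noteq> b" "x \<in> com E a b" "y \<in> com E a b" for x y
    using com_unique_if_C4_free[OF assms that(1)] that(2,3) by (simp add: com_def)
  then show ?thesis using finite_com[OF assms(1)] by (auto simp: codeg_def card_le_Suc0_iff_eq)
qed

lemma card_C6_lists_le_if_C4_free:
  assumes "E \<in> graphs_on n" "\<not> contains_cycle 4 E"
  shows "card (cyc_lists 6 E) \<le> n ^ 3"
proof -
  have "codeg E a b * codeg E b c * codeg E c a \<le> 1" for a b c
    using mult_le_mono[OF mult_le_mono[OF codeg_le_1_if_C4_free codeg_le_1_if_C4_free] codeg_le_1_if_C4_free, OF assms assms assms]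
    by simp
  then have "(\<Sum>a<n. \<Sum>b<n. \<Sum>c<n. codeg E a b * codeg E b c * codeg E c a) \<le> (\<Sum>a<n. \<Sum>b<n. \<Sum>c<n. 1)"
    by (intro sum_mono) blast
  also have "\<dots> = n ^ 3" by (simp add: power3_eq_cube)
  finally show ?thesis using card_C6_lists_le_sum_codeg[OF assms(1)] by linarith
qed

text \<open>The sum counts the walks \<open>a c b\<close> with \<open>b\<close> different from
  \<open>a\<close>, so \<open>card_two_walks_le\<close> applies.\<close>

lemma sum_codeg_le:
  assumes E: "E \<in> graphs_on n" and free: "\<not> contains_cycle (2 * k) E" and k: "2 \<le> k"
  shows "(\<Sum>b<n. codeg E a b) \<le> 4 * k * n"
proof -
  let ?S = "SIGMA b:{..<n} - {a}. com E a b"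
  have "(\<Sum>b<n. codeg E a b) = (\<Sum>b\<in>{..<n} - {a}. card (com E a b))"
    by (rule sum.mono_neutral_cong_right) (auto simp: codeg_def)
  also have "\<dots> = card ?S" using finite_com[OF E] by (subst card_SigmaI) auto
  also have "\<dots> = card (prod.swap ` ?S)" by (rule card_image[symmetric]) simp
  also have "\<dots> \<le> card {(c, b). {a, c} \<in> E \<and> {c, b} \<in> E \<and> b \<noteq> a}"
  proof (rule card_mono)
    show "finite {(c, b). {a, c} \<in> E \<and> {c, b} \<in> E \<and> b \<noteq> a}"
    proof (rule finite_subset)
      show "{(c, b). {a, c} \<in> E \<and> {c, b} \<in> E \<and> b \<noteq> a} \<subseteq> {..<n} \<times> {..<n}"
        using graphs_onD(1,2)[OF E] by blast
    qed simp
    show "prod.swap ` ?S \<subseteq> {(c, b). {a, c} \<in> E \<and> {c, b} \<in> E \<and> b \<noteq> a}"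
    proof
      fix p assume "p \<in> prod.swap ` ?S"
      then obtain q where q: "q \<in> ?S" "p = prod.swap q" by blast
      obtain b c where "q = (b, c)" by (cases q)
      with q have "p = (c, b)" "b \<noteq> a" "c \<in> com E a b" by simp_all
      then show "p \<in> {(c, b). {a, c} \<in> E \<and> {c, b} \<in> E \<and> b \<noteq> a}"
        by (simp add: com_def insert_commute)
    qed
  qed
  also have "\<dots> \<le> 4 * k * n" by (rule card_two_walks_le[OF assms])
  finally show ?thesis .
qed

text \<open>A squared codegree counts ordered pairs of common neighbours. Pairs of distinct ones
  form quadrilaterals, giving the 40 of \<open>card_C4_lists_le\<close>; equal ones give the
  codegree itself, adding 4 after summation.\<close>

lemma sum_codeg_squared_le:
  assumes E: "E \<in> graphs_on n" and free: "\<not> contains_cycle (2 * k) E" and k: "2 \<le> k"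
  shows "(\<Sum>a<n. \<Sum>b<n. (codeg E a b)\<^sup>2) \<le> 44 * k\<^sup>2 * n\<^sup>2"
proof -
  define Q where "Q p = {(x, y). x \<in> com E (fst p) (snd p) \<and> y \<in> com E (fst p) (snd p) \<and> x \<noteq> y \<and> fst p \<noteq> snd p}" for p
  have finQ: "finite (Q p)" for p
    using finite_com[OF E, of "fst p" "snd p"] by (auto simp: Q_def intro: finite_subset[of _ "com E (fst p) (snd p) \<times> com E (fst p) (snd p)"])
  have sq: "(codeg E a b)\<^sup>2 \<le> card (Q (a, b)) + codeg E a b" for a b
  proof (cases "a = b")
    case False
    have "com E a b \<times> com E a b \<subseteq> Q (a, b) \<union> (\<lambda>x. (x, x)) ` com E a b"
      using False by (auto simp: Q_def)
    then have "card (com E a b \<times> com E a b) \<le> card (Q (a, b) \<union> (\<lambda>x. (x, x)) ` com E a b)"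
      using finQ finite_com[OF E] by (intro card_mono) auto
    also have "\<dots> \<le> card (Q (a, b)) + card (com E a b)"
      using card_Un_le[of "Q (a, b)" "(\<lambda>x. (x, x)) ` com E a b"] card_image_le[OF finite_com[OF E, of a b], of "\<lambda>x. (x, x)"]
      by linarith
    finally show ?thesis using False by (simp add: codeg_def card_cartesian_product power2_eq_square)
  qed (simp add: codeg_def)
  let ?S = "SIGMA p:{..<n} \<times> {..<n}. Q p"
  have "(\<Sum>a<n. \<Sum>b<n. card (Q (a, b))) = card ?S"
    using finQ by (subst card_SigmaI) (auto simp: sum.cartesian_product)
  also have "\<dots> = card ((\<lambda>((a, b), (x, y)). [a, x, b, y]) ` ?S)"
    by (rule card_image[symmetric]) (auto simp: inj_on_def)
  also have "\<dots> \<le> card (cyc_lists 4 E)"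
  proof (rule card_mono)
    show "finite (cyc_lists 4 E)" using E by (simp add: finite_cyc_lists)
    show "(\<lambda>((a, b), (x, y)). [a, x, b, y]) ` ?S \<subseteq> cyc_lists 4 E"
      using graphs_onD(3)[OF E]
      by (auto simp: Q_def com_def cyc_lists_4_iff insert_commute)
  qed
  also have "\<dots> \<le> 40 * k\<^sup>2 * n\<^sup>2" by (rule card_C4_lists_le[OF assms])
  finally have 1: "(\<Sum>a<n. \<Sum>b<n. card (Q (a, b))) \<le> 40 * k\<^sup>2 * n\<^sup>2" .
  have "(\<Sum>a<n. \<Sum>b<n. codeg E a b) \<le> (\<Sum>a<n. 4 * k * n)" by (intro sum_mono sum_codeg_le assms)
  also have "\<dots> \<le> 4 * k\<^sup>2 * n\<^sup>2" by (simp add: power2_eq_square)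
  finally have 2: "(\<Sum>a<n. \<Sum>b<n. codeg E a b) \<le> 4 * k\<^sup>2 * n\<^sup>2" .
  have "(\<Sum>a<n. \<Sum>b<n. (codeg E a b)\<^sup>2) \<le> (\<Sum>a<n. \<Sum>b<n. card (Q (a, b)) + codeg E a b)"
    by (intro sum_mono sq)
  also have "\<dots> = (\<Sum>a<n. \<Sum>b<n. card (Q (a, b))) + (\<Sum>a<n. \<Sum>b<n. codeg E a b)"
    by (simp add: sum.distrib)
  finally show ?thesis using 1 2 by linarith
qed

text \<open>By \<open>2 * f * g <= f\<^sup>2 + g\<^sup>2\<close> the product of three codegrees is
  split into two terms, each a square times one other codegree. Renaming indices shows that both sum
  to \<open>W\<close>, where the two preceding bounds apply one after the other; 176 is 44 times
  4.\<close>

lemma card_C6_lists_le_if_even_cycle_free: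
  assumes E: "E \<in> graphs_on n" and free: "\<not> contains_cycle (2 * k) E" and k: "2 \<le> k"
  shows "card (cyc_lists 6 E) \<le> 176 * k ^ 3 * n ^ 3"
proof -
  let ?f = "codeg E"
  let ?Q = "\<Sum>a<n. \<Sum>b<n. (?f a b)\<^sup>2"
  have ineq: "2 * (f * g * h) \<le> h * f\<^sup>2 + h * g\<^sup>2" for f g h :: nat
  proof -
    have "2 * (f * g) \<le> f\<^sup>2 + g\<^sup>2"
      using sum_squares_bound[of "int f" "int g"] by (simp flip: of_nat_mult of_nat_add of_nat_power add: mult.assoc)
    then have "h * (2 * (f * g)) \<le> h * (f\<^sup>2 + g\<^sup>2)" by (rule mult_le_mono2)
    then show ?thesis by (simp add: algebra_simps)
  qed
  define W where "W = (\<Sum>a<n. \<Sum>b<n. (?f a b)\<^sup>2 * (\<Sum>c<n. ?f a c))"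
  have W1: "(\<Sum>a<n. \<Sum>b<n. \<Sum>c<n. ?f c a * (?f a b)\<^sup>2) = W"
    unfolding W_def sum_distrib_left by (intro sum.cong refl) (metis codeg_commute mult.commute)
  have "(\<Sum>a<n. \<Sum>b<n. \<Sum>c<n. ?f c a * (?f b c)\<^sup>2) = (\<Sum>b<n. \<Sum>a<n. \<Sum>c<n. ?f c a * (?f b c)\<^sup>2)"
    by (rule sum.swap)
  also have "\<dots> = (\<Sum>b<n. \<Sum>c<n. \<Sum>a<n. ?f c a * (?f b c)\<^sup>2)"
    by (rule sum.cong[OF refl sum.swap])
  also have "\<dots> = (\<Sum>c<n. \<Sum>b<n. \<Sum>a<n. ?f c a * (?f b c)\<^sup>2)"
    by (rule sum.swap)
  also have "\<dots> = W"
    unfolding W_def sum_distrib_left by (intro sum.cong refl) (metis codeg_commute mult.commute)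
  finally have W2: "(\<Sum>a<n. \<Sum>b<n. \<Sum>c<n. ?f c a * (?f b c)\<^sup>2) = W" .
  have "2 * (\<Sum>a<n. \<Sum>b<n. \<Sum>c<n. ?f a b * ?f b c * ?f c a)
      \<le> (\<Sum>a<n. \<Sum>b<n. \<Sum>c<n. ?f c a * (?f a b)\<^sup>2 + ?f c a * (?f b c)\<^sup>2)"
    unfolding sum_distrib_left by (intro sum_mono ineq)
  also have "\<dots> = W + W"
    by (simp add: sum.distrib W1 W2)
  finally have "(\<Sum>a<n. \<Sum>b<n. \<Sum>c<n. ?f a b * ?f b c * ?f c a) \<le> W" by linarith
  also have "W = (\<Sum>a<n. \<Sum>b<n. (?f a b)\<^sup>2 * (\<Sum>c<n. ?f a c))" by (rule W_def)
  also have "\<dots> \<le> (\<Sum>a<n. \<Sum>b<n. (?f a b)\<^sup>2 * (4 * k * n))"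
    by (intro sum_mono mult_le_mono2 sum_codeg_le assms)
  also have "\<dots> = ?Q * (4 * k * n)" by (simp add: sum_distrib_right)
  also have "\<dots> \<le> (44 * k\<^sup>2 * n\<^sup>2) * (4 * k * n)"
    by (intro mult_le_mono1 sum_codeg_squared_le assms)
  also have "\<dots> = 176 * k ^ 3 * n ^ 3" by (simp add: power2_eq_square power3_eq_cube)
  finally show ?thesis using card_C6_lists_le_sum_codeg[OF E] by linarith
qed

section \<open>Hexagons in graphs without quadrilaterals and a given longer even cycle\<close>

text \<open>Inner vertices of the paths of length three from \<open>a\<close> to \<open>b\<close>;
  for opposite vertices of a hexagon they play the part that \<open>com\<close> plays for the
  diagonals of a quadrilateral.\<close>

definition mid3 :: "nat set set \<Rightarrow> nat \<Rightarrow> nat \<Rightarrow> (nat \<times> nat) set" where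
  "mid3 E a b = {(x, y). gpath E [a, x, y, b]}"

lemma mid3_iff:
  "(x, y) \<in> mid3 E a b \<longleftrightarrow> distinct [a, x, y, b] \<and> {a, x} \<in> E \<and> {x, y} \<in> E \<and> {y, b} \<in> E"
  by (auto simp: mid3_def gpath_def)

lemma mid3_swap: "mid3 E b a = prod.swap ` mid3 E a b"
proof -
  have "(x, y) \<in> mid3 E b a \<longleftrightarrow> (y, x) \<in> mid3 E a b" for x y
    by (auto simp: mid3_iff insert_commute)
  then show ?thesis by (auto intro!: rev_image_eqI)
qed

lemma card_mid3_commute: "card (mid3 E a b) = card (mid3 E b a)"
  unfolding mid3_swap[of E b a] by (rule card_image[symmetric]) simp

lemma finite_mid3: "E \<in> graphs_on n \<Longrightarrow> finite (mid3 E a b)"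
proof (rule finite_subset)
  assume E: "E \<in> graphs_on n"
  show "mid3 E a b \<subseteq> {..<n} \<times> {..<n}"
    using graphs_onD(1,2)[OF E] by (fastforce simp: mid3_iff)
qed simp

text \<open>Without quadrilaterals each of \<open>x\<close> and \<open>y\<close> determines the
  other, since \<open>y\<close> is a common neighbour of \<open>x\<close> and \<open>b\<close>, and
  \<open>x\<close> one of \<open>a\<close> and \<open>y\<close>. Hence a vertex of \<open>Z\<close>
  spoils at most two paths.\<close>

lemma mid3_avoiding:
  assumes E: "E \<in> graphs_on n" and free: "\<not> contains_cycle 4 E"
    and Z: "finite Z" "2 * card Z < card (mid3 E a b)"
  obtains x y where "(x, y) \<in> mid3 E a b" "x \<notin> Z" "y \<notin> Z"
proof -
  let ?A = "{p \<in> mid3 E a b. fst p \<in> Z}" and ?B = "{p \<in> mid3 E a b. snd p \<in> Z}"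
  have "inj_on fst (mid3 E a b)"
  proof (rule inj_onI)
    fix p q assume p: "p \<in> mid3 E a b" and q: "q \<in> mid3 E a b" and eq: "fst p = fst q"
    obtain x y where pp: "p = (x, y)" by (cases p)
    obtain z where qq: "q = (x, z)" using eq pp by (cases q) auto
    have "y = z"
      using p q pp qq by (intro com_unique_if_C4_free[OF E free, of x b]) (auto simp: mid3_iff insert_commute)
    then show "p = q" using pp qq by simp
  qed
  then have "card ?A = card (fst ` ?A)" by (intro card_image[symmetric]) (auto simp: inj_on_def)
  also have "\<dots> \<le> card Z" using Z(1) by (intro card_mono) auto
  finally have A: "card ?A \<le> card Z" .
  have "inj_on snd (mid3 E a b)"
  proof (rule inj_onI)
    fix p q assume p: "p \<in> mid3 E a b" and q: "q \<in> mid3 E a b" and eq: "snd p = snd q"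
    obtain x y where pp: "p = (x, y)" by (cases p)
    obtain z where qq: "q = (z, y)" using eq pp by (cases q) auto
    have "x = z"
      using p q pp qq by (intro com_unique_if_C4_free[OF E free, of a y]) (auto simp: mid3_iff insert_commute)
    then show "p = q" using pp qq by simp
  qed
  then have "card ?B = card (snd ` ?B)" by (intro card_image[symmetric]) (auto simp: inj_on_def)
  also have "\<dots> \<le> card Z" using Z(1) by (intro card_mono) auto
  finally have "card (?A \<union> ?B) < card (mid3 E a b)"
    using A Z(2) card_Un_le[of ?A ?B] by linarith
  moreover have "finite (?A \<union> ?B)" using finite_mid3[OF E] by simp
  ultimately obtain p where "p \<in> mid3 E a b" "p \<notin> ?A \<union> ?B" using ex_not_in_if_card_less by blast
  then show thesis using that[of "fst p" "snd p"] by auto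
qed

text \<open>The situation that \<open>cyclic_core\<close> produces for hexagons with
  \<open>r = 3\<close>. The bound in \<open>deg\<close> is the number of hexagons that
  \<open>pick\<close> may have to discard; the bound in \<open>fat\<close> is twice the
  \<open>2 * k + 2\<close> vertices that a path of length three may have to avoid.\<close>

locale fat_C6_core =
  fixes E :: "nat set set" and n k :: nat and H :: "nat list set"
  assumes E: "E \<in> graphs_on n" and free: "\<not> contains_cycle 4 E"
    and sub: "H \<subseteq> cyc_lists 6 E" and nonempty: "H \<noteq> {}"
    and rot: "\<And>h. h \<in> H \<Longrightarrow> rotate1 h \<in> H" and rev: "\<And>h. h \<in> H \<Longrightarrow> rev h \<in> H"
    and deg: "\<And>h. h \<in> H \<Longrightarrow> 2 * k + 4 * k\<^sup>2 < card {h'\<in>H. take 3 h' = take 3 h}"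
    and fat: "\<And>a b c d e f. [a, b, c, d, e, f] \<in> H \<Longrightarrow> 4 * k + 4 < card (mid3 E a d)"
    and k: "4 \<le> k"
begin

lemma rot_list: "[a, b, c, d, e, f] \<in> H \<Longrightarrow> [b, c, d, e, f, a] \<in> H"
  using rot[of "[a, b, c, d, e, f]"] by simp

lemma rev_list: "[a, b, c, d, e, f] \<in> H \<Longrightarrow> [a, f, e, d, c, b] \<in> H"
  using rev[of "[b, c, d, e, f, a]"] rot_list by simp

lemma edges:
  assumes "[a, b, c, d, e, f] \<in> H"
  shows "distinct [a, b, c, d, e, f]" "{a, b} \<in> E" "{b, c} \<in> E" "{c, d} \<in> E" "{d, e} \<in> E" "{e, f} \<in> E" "{f, a} \<in> E"
  using assms sub cyc_lists_6_iff by blast+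

text \<open>Without quadrilaterals a hexagon starting with \<open>u v w\<close> is determined by
  \<open>e\<close>, because \<open>d\<close> is the common neighbour of \<open>w\<close> and
  \<open>e\<close>, and \<open>f\<close> that of \<open>u\<close> and \<open>e\<close>. It is also
  determined by \<open>d\<close> and \<open>f\<close>. So at most \<open>2 * k\<close> hexagons have
  \<open>e\<close> in \<open>Z\<close>, and at most \<open>4 * k\<^sup>2\<close> have both
  \<open>d\<close> and \<open>f\<close> in \<open>Z\<close>.\<close>

lemma pick:
  assumes h: "[u, v, w, d0, e0, f0] \<in> H" and Z: "finite Z" "card Z \<le> 2 * k"
  obtains d e f where "[u, v, w, d, e, f] \<in> H" "e \<notin> Z" "d \<notin> Z \<or> f \<notin> Z"
proof -
  let ?G = "{h'\<in>H. take 3 h' = [u, v, w]}"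
  have form: "\<exists>d e f. h = [u, v, w, d, e, f]" if "h \<in> ?G" for h
  proof -
    have "length h = 6" using that sub by (auto simp: cyc_lists_def)
    then obtain a b c d e f where "h = [a, b, c, d, e, f]" unfolding length_6_conv by blast
    then show ?thesis using that by auto
  qed
  have same: "d = d'" "f = f'" if "[u, v, w, d, e, f] \<in> H" "[u, v, w, d', e, f'] \<in> H" for d e f d' f'
    using edges[OF that(1)] edges[OF that(2)]
      com_unique_if_C4_free[OF E free, of w e d d'] com_unique_if_C4_free[OF E free, of u e f f']
    by (auto simp: insert_commute)
  have same': "e = e'" if "[u, v, w, d, e, f] \<in> H" "[u, v, w, d, e', f] \<in> H" for d e f e'
    using edges[OF that(1)] edges[OF that(2)] com_unique_if_C4_free[OF E free, of d f e e']
    by (auto simp: insert_commute)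
  let ?A = "{h\<in>?G. h ! 4 \<in> Z}" and ?B = "{h\<in>?G. h ! 3 \<in> Z \<and> h ! 5 \<in> Z}"
  have "inj_on (\<lambda>h. h ! 4) ?A"
  proof (rule inj_onI)
    fix g h assume g: "g \<in> ?A" and h: "h \<in> ?A" and eq: "g ! 4 = h ! 4"
    obtain d e f d' e' f' where "g = [u, v, w, d, e, f]" "h = [u, v, w, d', e', f']"
      using form[of g] form[of h] g h by blast
    then show "g = h" using g h eq same[of d e f d' f'] by auto
  qed
  then have "card ?A = card ((\<lambda>h. h ! 4) ` ?A)" by (rule card_image[symmetric])
  also have "\<dots> \<le> card Z" using Z by (intro card_mono) auto
  finally have A: "card ?A \<le> 2 * k" using Z by linarith
  have "inj_on (\<lambda>h. (h ! 3, h ! 5)) ?B"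
  proof (rule inj_onI)
    fix g h assume g: "g \<in> ?B" and h: "h \<in> ?B" and eq: "(g ! 3, g ! 5) = (h ! 3, h ! 5)"
    obtain d e f d' e' f' where gh: "g = [u, v, w, d, e, f]" "h = [u, v, w, d', e', f']"
      using form[of g] form[of h] g h by blast
    then have "d = d'" "f = f'" using eq by auto
    then show "g = h" using g h gh same'[of d e f e'] by auto
  qed
  then have "card ?B = card ((\<lambda>h. (h ! 3, h ! 5)) ` ?B)" by (rule card_image[symmetric])
  also have "\<dots> \<le> card (Z \<times> Z)" using Z by (intro card_mono) auto
  also have "\<dots> \<le> (2 * k) * (2 * k)" unfolding card_cartesian_product by (intro mult_le_mono Z)
  finally have B: "card ?B \<le> 4 * k\<^sup>2" by (simp add: power2_eq_square)
  have "finite H" using sub finite_cyc_lists[OF E, of 6] finite_subset by auto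
  then have "finite (?A \<union> ?B)" by simp
  moreover have "card (?A \<union> ?B) < card ?G"
    using deg[OF h] A B card_Un_le[of ?A ?B] by simp
  ultimately obtain h where hG: "h \<in> ?G" "h \<notin> ?A \<union> ?B" using ex_not_in_if_card_less by blast
  then obtain d e f where "h = [u, v, w, d, e, f]" using form by blast
  then show thesis using hG that[of d e f] by auto
qed

lemma mid3_avoiding':
  assumes "[a, b, c, d, e, f] \<in> H" "finite Z" "card Z \<le> 2 * k + 2"
  obtains x y where "(x, y) \<in> mid3 E a d" "x \<notin> Z" "y \<notin> Z"
proof -
  have "2 * card Z < card (mid3 E a d)" using fat[OF assms(1)] assms(3) by linarith
  then show thesis using that by (rule mid3_avoiding[OF E free assms(2)])
qed

text \<open>
  A cycle of length \<open>m + 1\<close>, split into a vertex \<open>v\<close> and the remaining path \<open>xs\<close>, such that \<open>v\<close> and its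
  two neighbours on the cycle are consecutive in a hexagon of the core.
\<close>

definition marked :: "nat \<Rightarrow> bool" where
  "marked m \<longleftrightarrow> (\<exists>xs v d e f. gpath E xs \<and> length xs = m \<and> v \<notin> set xs \<and> [last xs, v, hd xs, d, e, f] \<in> H)"

lemma markedI:
  "gpath E xs \<Longrightarrow> length xs = m \<Longrightarrow> v \<notin> set xs \<Longrightarrow> [last xs, v, hd xs, d, e, f] \<in> H \<Longrightarrow> marked m"
  unfolding marked_def by blast

lemma hexagon: obtains a b c d e f where "[a, b, c, d, e, f] \<in> H"
proof -
  obtain h where h: "h \<in> H" using nonempty by blast
  then have "length h = 6" using sub by (auto simp: cyc_lists_def)
  then show thesis using h that unfolding length_6_conv by blast
qed

lemma marked_5: "marked 5"
proof -
  obtain a b c d e f where h: "[a, b, c, d, e, f] \<in> H" by (rule hexagon)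
  have "gpath E [c, d, e, f, a]" using edges[OF h] by (auto simp: gpath_def)
  then show ?thesis using h edges(1)[OF h]
    by (intro markedI[of "[c, d, e, f, a]" _ b d e f]) auto
qed

text \<open>An eight-cycle comes from two core hexagons sharing \<open>v6 v1 v2\<close>. In the
  first, these three vertices are replaced by \<open>v6 f x y v2\<close> or
  \<open>v6 x y d v2\<close>, where \<open>f\<close> or \<open>d\<close> is a new vertex of the
  second and \<open>x\<close>, \<open>y\<close> join opposite vertices of it. The vertex
  \<open>v3\<close> keeps its neighbours \<open>v2\<close> and \<open>v4\<close>, hence its mark in
  the first hexagon.\<close>

lemma marked_7: "marked 7"
proof -
  obtain v6 v1 v2 v3 v4 v5 where h: "[v6, v1, v2, v3, v4, v5] \<in> H" by (rule hexagon)
  let ?Z = "{v1, v2, v3, v4, v5, v6}"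
  have h': "[v2, v3, v4, v5, v6, v1] \<in> H" using h rot_list by blast
  have Z: "card ?Z \<le> 6" by (simp add: card_insert_if)
  have Z2: "finite ?Z" "card ?Z \<le> 2 * k" using Z k by simp_all
  obtain d e f where g: "[v6, v1, v2, d, e, f] \<in> H" "e \<notin> ?Z" "d \<notin> ?Z \<or> f \<notin> ?Z"
    by (rule pick[OF h Z2])
  have Z': "finite ?Z" "card ?Z \<le> 2 * k + 2" using Z2 by simp_all
  note eh = edges[OF h] and eg = edges[OF g(1)]
  from g(3) show ?thesis
  proof
    assume f: "f \<notin> ?Z"
    have g': "[f, v6, v1, v2, d, e] \<in> H" using g(1) rot_list by blast
    obtain x y where xy: "(x, y) \<in> mid3 E f v2" "x \<notin> ?Z" "y \<notin> ?Z"
      by (rule mid3_avoiding'[OF g' Z'])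
    then have "gpath E [v4, v5, v6, f, x, y, v2]"
      using eh eg f by (auto simp: gpath_def mid3_iff insert_commute)
    moreover have "v3 \<notin> set [v4, v5, v6, f, x, y, v2]" using eh(1) f xy by auto
    ultimately show ?thesis using h'
      by (intro markedI[of "[v4, v5, v6, f, x, y, v2]" _ v3 v5 v6 v1]) auto
  next
    assume d: "d \<notin> ?Z"
    obtain x y where xy: "(x, y) \<in> mid3 E v6 d" "x \<notin> ?Z" "y \<notin> ?Z"
      by (rule mid3_avoiding'[OF g(1) Z'])
    then have "gpath E [v4, v5, v6, x, y, d, v2]"
      using eh eg d by (auto simp: gpath_def mid3_iff insert_commute)
    moreover have "v3 \<notin> set [v4, v5, v6, x, y, d, v2]" using eh(1) d xy by auto
    ultimately show ?thesis using h'
      by (intro markedI[of "[v4, v5, v6, x, y, d, v2]" _ v3 v5 v6 v1]) auto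
  qed
qed

text \<open>
  Replace \<open>u v w\<close> by \<open>u f e y x v w\<close>, or symmetrically by \<open>u v x y e d w\<close>, where \<open>u v w d e f\<close> is a hexagon
  of the core; \<open>x\<close> and \<open>y\<close> exist because \<open>v\<close> and \<open>e\<close> are opposite.
\<close>

lemma marked_plus_4:
  assumes "marked m" "0 < m" "m + 1 \<le> 2 * k"
  shows "marked (m + 4)"
proof -
  obtain xs v d0 e0 f0 where xs: "gpath E xs" "length xs = m" "v \<notin> set xs"
    "[last xs, v, hd xs, d0, e0, f0] \<in> H" using assms(1) unfolding marked_def by blast
  define u w where "u = last xs" and "w = hd xs"
  have ne: "xs \<noteq> []" using xs(2) assms(2) by auto
  let ?Z = "insert v (set xs)"
  have Z: "card ?Z \<le> 2 * k" using card_length[of xs] xs(2) assms(3) by (simp add: card_insert_if)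
  obtain d e f where g: "[u, v, w, d, e, f] \<in> H" "e \<notin> ?Z" "d \<notin> ?Z \<or> f \<notin> ?Z"
    unfolding u_def w_def by (rule pick[OF xs(4) _ Z]) auto
  note eg = edges[OF g(1)]
  have g': "[v, w, d, e, f, u] \<in> H" using g(1) rot_list by blast
  have Z': "finite (insert z (insert e ?Z))" "card (insert z (insert e ?Z)) \<le> 2 * k + 2" for z
    using Z by (auto simp: card_insert_if)
  from g(3) show ?thesis
  proof
    assume f: "f \<notin> ?Z"
    obtain x y where xy: "(x, y) \<in> mid3 E v e" "x \<notin> insert f (insert e ?Z)" "y \<notin> insert f (insert e ?Z)"
      by (rule mid3_avoiding'[OF g' Z'[of f]])
    \<comment> \<open>The new marked vertex is \<open>f\<close>, between \<open>u\<close> and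
      \<open>e\<close>. In the symmetric case it is \<open>d\<close>, between \<open>e\<close> and
      \<open>w\<close>.\<close>
    have "gpath E ([e, y, x, v] @ xs)"
      using xy xs(1,3) g(2) ne eg by (auto simp: gpath_def mid3_iff successively_Cons w_def insert_commute)
    moreover have "f \<notin> set ([e, y, x, v] @ xs)" using f xy eg(1) by auto
    moreover have "[u, f, e, d, w, v] \<in> H" using g(1) by (rule rev_list)
    ultimately show ?thesis 
      using xs(2) ne by (intro markedI[of "[e, y, x, v] @ xs" _ f d w v]) (auto simp: u_def)
  next
    assume d: "d \<notin> ?Z"
    obtain x y where xy: "(x, y) \<in> mid3 E v e" "x \<notin> insert d (insert e ?Z)" "y \<notin> insert d (insert e ?Z)"
      by (rule mid3_avoiding'[OF g' Z'[of d]])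
    have "gpath E (xs @ [v, x, y, e])"
      using xy xs(1,3) g(2) ne eg
      by (auto simp: gpath_def mid3_iff successively_append_iff u_def insert_commute)
    moreover have "d \<notin> set (xs @ [v, x, y, e])" using d xy eg(1) by auto
    moreover have "[e, d, w, v, u, f] \<in> H" using rev_list[OF g(1)] rot_list by blast
    ultimately show ?thesis 
      using xs(2) ne by (intro markedI[of "xs @ [v, x, y, e]" _ d v u f]) (auto simp: w_def)
  qed
qed

lemma marked_odd: "odd m \<Longrightarrow> 5 \<le> m \<Longrightarrow> m + 1 \<le> 2 * k \<Longrightarrow> marked m"
proof (induction m rule: less_induct)
  case (less m)
  \<comment> \<open>The vertex \<open>v\<close> is not counted in \<open>m\<close>, so odd
    \<open>m\<close> belong to even cycles; 5 and 7 represent the two odd classes modulo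
    four.\<close>
  have "m = 5 \<or> m = 7 \<or> 9 \<le> m" using less.prems by presburger
  then consider "m = 5" | "m = 7" | "9 \<le> m" by blast
  then show ?case
  proof cases
    case 3
    then have "marked (m - 4 + 4)"
      using less.prems by (intro marked_plus_4 less.IH) auto
    then show ?thesis using 3 by simp
  qed (use marked_5 marked_7 in auto)
qed

lemma contains_long_cycle: "contains_cycle (2 * k) E"
proof -
  have "marked (2 * k - 1)" using k by (intro marked_odd) auto
  then obtain xs v d e f where xs: "gpath E xs" "length xs = 2 * k - 1" "v \<notin> set xs"
    "[last xs, v, hd xs, d, e, f] \<in> H" unfolding marked_def by blast
  have "xs \<noteq> []" using xs(2) k by auto
  then show ?thesis
    using xs edges[OF xs(4)] k
    by (intro contains_cycleI[of E "v # xs"]) (auto simp: gpath_def successively_Cons)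
qed

end

text \<open>The first term counts hexagons with one of the three pairs of opposite vertices thin:
  choose the pair and two paths of length three. The second is the threshold of
  \<open>cyclic_core\<close> for lists of length six, with 12 as \<open>2 * 6\<close>.\<close>

lemma card_C6_lists_le_if_C4_even_cycle_free:
  assumes E: "E \<in> graphs_on n" and free4: "\<not> contains_cycle 4 E"
    and free: "\<not> contains_cycle (2 * k) E" and k: "4 \<le> k"
  shows "card (cyc_lists 6 E) \<le> (3 * (4 * k + 4)\<^sup>2 + 12 * (2 * k + 4 * k\<^sup>2)) * n\<^sup>2"
proof -
  let ?L = "cyc_lists 6 E" and ?t = "4 * k + 4" and ?M = "2 * k + 4 * k\<^sup>2"
  have finL: "finite ?L" using E by (simp add: finite_cyc_lists)
  define T where "T i = {h\<in>?L. card (mid3 E (h ! i) (h ! (i + 3))) \<le> ?t}" for i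
  define H where "H = {h\<in>?L. \<forall>i\<in>{0,1,2}. ?t < card (mid3 E (h ! i) (h ! (i + 3)))}"
  have fin: "finite (T i)" "finite H" for i using finL by (auto simp: T_def H_def)
  have form: "\<exists>a b c d e f. h = [a, b, c, d, e, f]" if "h \<in> ?L" for h
    using that unfolding length_6_conv[symmetric] by (simp add: cyc_lists_def)
  have L: "?L = T 0 \<union> T 1 \<union> T 2 \<union> H" by (auto simp: T_def H_def not_le)
  define I where "I = {p\<in>{..<n} \<times> {..<n}. card (mid3 E (fst p) (snd p)) \<le> ?t}"
  have finI: "finite I" by (simp add: I_def)
  let ?S = "SIGMA p:I. mid3 E (fst p) (snd p) \<times> mid3 E (fst p) (snd p)"
  let ?f = "\<lambda>((a, b), ((x, y), (z, w))). [a, x, y, b, w, z :: nat]"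
  have "T 0 \<subseteq> ?f ` ?S"
  proof
    fix h assume h: "h \<in> T 0"
    then obtain a x y b w z where hh: "h = [a, x, y, b, w, z]" using form[of h] h unfolding T_def by blast
    have "h \<in> ?L" using h by (simp add: T_def)
    then have "((a, b), ((x, y), (z, w))) \<in> ?S"
      using h graphs_onD(1,2)[OF E] unfolding hh cyc_lists_6_iff
      by (auto simp: T_def I_def mid3_iff insert_commute)
    then show "h \<in> ?f ` ?S" by (rule rev_image_eqI) (simp add: hh)
  qed
  moreover have "finite ?S" using finite_mid3[OF E] finI by (intro finite_SigmaI) auto
  ultimately have "card (T 0) \<le> card ?S" by (meson card_image_le card_mono finite_imageI order_trans)
  also have "\<dots> = (\<Sum>p\<in>I. card (mid3 E (fst p) (snd p)) * card (mid3 E (fst p) (snd p)))"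
    using finite_mid3[OF E] finI by (subst card_SigmaI) (auto simp: card_cartesian_product)
  also have "\<dots> \<le> (\<Sum>p\<in>I. ?t * ?t)"
    by (intro sum_mono mult_le_mono) (auto simp: I_def)
  also have "\<dots> \<le> (\<Sum>p\<in>{..<n} \<times> {..<n}. ?t * ?t)"
    by (intro sum_mono2) (auto simp: I_def)
  also have "\<dots> = ?t\<^sup>2 * n\<^sup>2" by (simp add: card_cartesian_product power2_eq_square)
  finally have T0: "card (T 0) \<le> ?t\<^sup>2 * n\<^sup>2" .
  \<comment> \<open>Rotating by one turns the opposite positions \<open>i + 1\<close> and
    \<open>i + 4\<close> into \<open>i\<close> and \<open>i + 3\<close>.\<close>
  have step: "card (T (Suc i)) \<le> card (T i)" if "i < 2" for i
  proof -
    have "rotate1 ` T (Suc i) \<subseteq> T i"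
    proof
      fix g assume "g \<in> rotate1 ` T (Suc i)"
      then obtain h where h: "h \<in> T (Suc i)" "g = rotate1 h" by blast
      then obtain a b c d e f where hh: "h = [a, b, c, d, e, f]" using form[of h] h unfolding T_def by blast
      have "i = 0 \<or> i = 1" using that by auto
      then show "g \<in> T i" using h hh cyc_lists_rotate1[of 6 h E] by (auto simp: T_def)
    qed
    then have "card (rotate1 ` T (Suc i)) \<le> card (T i)" by (intro card_mono fin)
    then show ?thesis by (simp add: card_image inj_on_subset[OF inj_rotate1])
  qed
  have T: "card (T 0) \<le> ?t\<^sup>2 * n\<^sup>2" "card (T 1) \<le> ?t\<^sup>2 * n\<^sup>2" "card (T 2) \<le> ?t\<^sup>2 * n\<^sup>2"
    using T0 step[of 0] step[of 1] by (auto simp: numeral_2_eq_2)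
  have H: "card H \<le> 12 * ?M * n\<^sup>2"
  proof (rule ccontr)
    assume neg: "\<not> ?thesis"
    \<comment> \<open>The ends of a path of length two determine its middle vertex, as there is no
      quadrilateral. So \<open>take 3\<close> has at most \<open>n\<^sup>2\<close> values on
      \<open>H\<close>, where a bare count of triples would give \<open>n ^ 3\<close>.\<close>
    have "inj_on (\<lambda>h. (h ! 0, h ! 2)) (take 3 ` H)"
    proof (rule inj_onI)
      fix p q assume p: "p \<in> take 3 ` H" and q: "q \<in> take 3 ` H" and eq: "(p ! 0, p ! 2) = (q ! 0, q ! 2)"
      obtain g h where gh: "g \<in> ?L" "p = take 3 g" "h \<in> ?L" "q = take 3 h" using p q by (auto simp: H_def)
      obtain a b c d e f where g: "g = [a, b, c, d, e, f]" using form gh(1) by blast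
      obtain a' b' c' d' e' f' where h: "h = [a', b', c', d', e', f']" using form gh(3) by blast
      have "a' = a" "c' = c" using eq gh g h by auto
      moreover have "b = b'"
        using gh(1,3) \<open>a' = a\<close> \<open>c' = c\<close> unfolding g h cyc_lists_6_iff
        by (intro com_unique_if_C4_free[OF E free4, of a c]) (auto simp: insert_commute)
      ultimately show "p = q" using gh g h by simp
    qed
    then have "card (take 3 ` H) = card ((\<lambda>h. (h ! 0, h ! 2)) ` take 3 ` H)" by (rule card_image[symmetric])
    also have "\<dots> \<le> card ({..<n} \<times> {..<n})"
    proof (rule card_mono)
      show "(\<lambda>h. (h ! 0, h ! 2)) ` take 3 ` H \<subseteq> {..<n} \<times> {..<n}"
      proof
        fix p assume "p \<in> (\<lambda>h. (h ! 0, h ! 2)) ` take 3 ` H"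
        then obtain h where h: "h \<in> ?L" "p = (h ! 0, h ! 2)" by (auto simp: H_def)
        then have "set h \<subseteq> {..<n}" "length h = 6" using cyc_lists_subset[OF E, of 6] by auto
        then have "h ! 0 \<in> {..<n}" "h ! 2 \<in> {..<n}" by (auto simp: subset_iff)
        then show "p \<in> {..<n} \<times> {..<n}" using h(2) by simp
      qed
    qed simp
    finally have "2 * 6 * ?M * card (take 3 ` H) \<le> 2 * 6 * ?M * n\<^sup>2"
      by (intro mult_le_mono2) (simp add: card_cartesian_product power2_eq_square)
    also have "\<dots> < card H" using neg by simp
    finally have big: "2 * 6 * ?M * card (take 3 ` H) < card H" .
    have Hrot: "rotate1 h \<in> H" if h: "h \<in> H" for h
    proof -
      obtain a b c d e f where "h = [a, b, c, d, e, f]" using form[of h] h unfolding H_def by blast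
      then show ?thesis using h cyc_lists_rotate1[of 6 h E] card_mid3_commute[of E a d] by (auto simp: H_def)
    qed
    have Hrev: "rev h \<in> H" if h: "h \<in> H" for h
    proof -
      obtain a b c d e f where "h = [a, b, c, d, e, f]" using form[of h] h unfolding H_def by blast
      then show ?thesis
        using h cyc_lists_rev[of h 6 E] card_mid3_commute[of E a d] card_mid3_commute[of E b e] card_mid3_commute[of E c f]
        by (auto simp: H_def)
    qed
    have len: "length h = 6" if "h \<in> H" for h using that by (auto simp: H_def cyc_lists_def)
    obtain H' where H': "H' \<subseteq> H" "H' \<noteq> {}"
      "\<And>h. h \<in> H' \<Longrightarrow> rotate1 h \<in> H'" "\<And>h. h \<in> H' \<Longrightarrow> rev h \<in> H'"
      "\<And>h. h \<in> H' \<Longrightarrow> ?M < card {h'\<in>H'. take 3 h' = take 3 h}"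
      by (rule cyclic_core[OF fin(2) len _ Hrot Hrev big]) auto
    have "fat_C6_core E n k H'"
    proof
      fix a b c d e f assume "[a, b, c, d, e, f] \<in> H'"
      then show "?t < card (mid3 E a d)" using H'(1) by (auto simp: H_def)
    qed (use E free4 k H' in \<open>auto simp: H_def\<close>)
    then show False using fat_C6_core.contains_long_cycle free by blast
  qed
  have "card ?L \<le> card (T 0) + card (T 1) + card (T 2) + card H"
    unfolding L using card_Un_le[of "T 0 \<union> T 1 \<union> T 2" H] card_Un_le[of "T 0 \<union> T 1" "T 2"] card_Un_le[of "T 0" "T 1"]
    by linarith
  also have "\<dots> \<le> 3 * (?t\<^sup>2 * n\<^sup>2) + 12 * ?M * n\<^sup>2" using T H by linarith
  also have "\<dots> = (3 * ?t\<^sup>2 + 12 * ?M) * n\<^sup>2" by (simp only: distrib_right mult.assoc)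
  finally show ?thesis .
qed

section \<open>Constructions with many hexagons\<close>

text \<open>Walking around the cycle forever gives an indexing by all natural numbers, which spares
  the separate treatment of the closing edge.\<close>

lemma contains_cycle_periodic:
  assumes "contains_cycle k E"
  obtains g :: "nat \<Rightarrow> nat" where "3 \<le> k" "\<forall>i. {g i, g (Suc i)} \<in> E"
    "\<forall>i j. g i = g j \<longleftrightarrow> i mod k = j mod k"
proof -
  from assms obtain xs where k: "3 \<le> k" and "xs \<in> cyc_lists k E" by (auto simp: contains_cycle_iff)
  then have xs: "length xs = k" "distinct xs" "cedges xs \<subseteq> E" by (simp_all add: cyc_lists_alt)
  have lt: "i mod k < k" for i using k by simp
  show thesis
  proof (rule that[of "\<lambda>i. xs ! (i mod k)"]; (intro allI)?)
    fix i
    have "{xs ! (i mod k), xs ! ((i mod k + 1) mod k)} \<in> cedges xs"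
      using lt[of i] xs(1) unfolding cedges_def by blast
    then show "{xs ! (i mod k), xs ! (Suc i mod k)} \<in> E"
      using xs(3) by (auto simp: mod_Suc_eq)
  next
    fix i j
    show "xs ! (i mod k) = xs ! (j mod k) \<longleftrightarrow> i mod k = j mod k"
      using xs(1,2) lt by (simp add: nth_eq_iff_index_eq)
  qed (rule k)
qed

lemma cycle_in_bipartite:
  assumes bip: "\<And>u v. {u, v} \<in> E \<Longrightarrow> u \<in> S \<longleftrightarrow> v \<notin> S" and cyc: "contains_cycle k E"
  shows "even k" and "finite S \<Longrightarrow> k \<le> 2 * card S"
proof -
  from cyc obtain g where "3 \<le> k" "\<forall>i. {g i, g (Suc i)} \<in> E" "\<forall>i j. g i = g j \<longleftrightarrow> i mod k = j mod k"
    by (rule contains_cycle_periodic)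
  then have g: "3 \<le> k" "\<And>i. {g i, g (Suc i)} \<in> E" "\<And>i j. g i = g j \<longleftrightarrow> i mod k = j mod k" by simp_all
  have alt: "g i \<in> S \<longleftrightarrow> (g 0 \<in> S \<longleftrightarrow> even i)" for i
  proof (induction i)
    case (Suc i)
    then show ?case using bip[OF g(2)[of i]] by auto
  qed simp
  have "g k = g 0" unfolding g(3) by simp
  then show ev: "even k" using alt[of k] by auto
  assume fin: "finite S"
  \<comment> \<open>The offset of the first vertex in \<open>S\<close>; from there on every second
    vertex is in \<open>S\<close>.\<close>
  define s :: nat where "s = (if g 0 \<in> S then 0 else 1)"
  let ?f = "\<lambda>i. g (2 * i + s)"
  have lt: "2 * i + s < k" if "i < k div 2" for i
    using that ev by (auto simp: s_def elim!: evenE)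
  have "inj_on ?f {..<k div 2}"
    using lt by (auto simp: inj_on_def g(3))
  then have "k div 2 = card (?f ` {..<k div 2})" by (simp add: card_image)
  also have "\<dots> \<le> card S"
  proof (rule card_mono[OF fin])
    have "?f i \<in> S" for i using alt[of "2 * i + s"] by (simp add: s_def)
    then show "?f ` {..<k div 2} \<subseteq> S" by blast
  qed
  finally show "k \<le> 2 * card S" using ev by auto
qed

lemma card_le_ex_cycle:
  assumes E: "E \<in> graphs_on n" and free: "\<And>a. a \<in> A \<Longrightarrow> \<not> contains_cycle a E"
    and inj: "inj_on f I" and sub: "f ` I \<subseteq> cyc_lists 6 E"
  shows "card I \<le> 6 ^ 6 * ex_cycle n 6 A"
proof -
  have "card I = card (f ` I)" using inj by (simp add: card_image)
  also have "\<dots> \<le> card (cyc_lists 6 E)" using sub finite_cyc_lists[OF E] by (intro card_mono) auto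
  also have "\<dots> \<le> 6 ^ 6 * num_cycles 6 E" by (rule card_cyc_lists_le_num_cycles[OF E]) simp
  also have "\<dots> \<le> 6 ^ 6 * ex_cycle n 6 A"
    using num_cycles_le_ex_cycle[OF E, of A 6] free by (intro mult_le_mono2) blast
  finally show ?thesis .
qed

section \<open>Complete bipartite graphs\<close>

definition graph_of :: "(nat \<Rightarrow> nat \<Rightarrow> bool) \<Rightarrow> nat set set" where
  "graph_of P = {{u, v} | u v. P u v}"

lemma graph_of_iff: "{u, v} \<in> graph_of P \<longleftrightarrow> P u v \<or> P v u"
  by (auto simp: graph_of_def doubleton_eq_iff)

lemma graph_of_in_graphs_on:
  "(\<And>u v. P u v \<Longrightarrow> u < n \<and> v < n \<and> u \<noteq> v) \<Longrightarrow> graph_of P \<in> graphs_on n"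
  by (fastforce simp: graph_of_def graphs_on_def)

lemma ex_cycle_lower_6:
  assumes "\<And>a. a \<in> A \<Longrightarrow> odd a"
  shows "(n div 6) ^ 6 \<le> 6 ^ 6 * ex_cycle n 6 A"
proof -
  define r where "r = n div 6"
  \<comment> \<open>Six blocks of \<open>r\<close> vertices, with all edges between even and odd
    blocks; one vertex from each block in turn forms a hexagon.\<close>
  define P where "P u v \<longleftrightarrow> u < 6 * r \<and> v < 6 * r \<and> even (u div r) \<and> odd (v div r)" for u v
  let ?E = "graph_of P"
  let ?f = "\<lambda>(a, b, c, d, e, f). [a, r + b, 2 * r + c, 3 * r + d, 4 * r + e, 5 * r + f]"
  let ?I = "{..<r} \<times> {..<r} \<times> {..<r} \<times> {..<r} \<times> {..<r} \<times> {..<r}"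
  have "6 * r \<le> n" by (simp add: r_def)
  then have E: "?E \<in> graphs_on n" by (intro graph_of_in_graphs_on) (auto simp: P_def)
  have "even a" if "contains_cycle a ?E" for a
    by (rule cycle_in_bipartite(1)[OF _ that, of "{u. even (u div r)}"]) (auto simp: graph_of_iff P_def)
  then have "\<not> contains_cycle a ?E" if "a \<in> A" for a using assms that by blast
  moreover have "inj_on ?f ?I" by (auto simp: inj_on_def)
  moreover have "?f ` ?I \<subseteq> cyc_lists 6 ?E"
    by (auto simp: cyc_lists_6_iff graph_of_iff P_def)
  ultimately have "card ?I \<le> 6 ^ 6 * ex_cycle n 6 A" by (rule card_le_ex_cycle[OF E])
  moreover have "card ?I = r ^ 6" by (simp add: card_cartesian_product numeral_eq_Suc)
  ultimately show ?thesis by (simp only: r_def)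
qed

text \<open>A cycle of the complete bipartite graph with three vertices on one side has length four
  or six. Three disjoint blocks of size \<open>r\<close> on the other side supply the vertices
  between 0, 1 and 2.\<close>

lemma ex_cycle_lower_3:
  assumes "\<And>a. a \<in> A \<Longrightarrow> 3 \<le> a" "4 \<notin> A" "6 \<notin> A"
  shows "((n - 3) div 3) ^ 3 \<le> 6 ^ 6 * ex_cycle n 6 A"
proof (cases "3 \<le> n")
  case True
  define r where "r = (n - 3) div 3"
  define P where "P u v \<longleftrightarrow> u < 3 \<and> 3 \<le> v \<and> v < n" for u v :: nat
  let ?E = "graph_of P"
  let ?f = "\<lambda>(x, y, z). [0, 3 + x, 1, 3 + r + y, 2, 3 + 2 * r + z]"
  let ?I = "{..<r} \<times> {..<r} \<times> {..<r}"
  have r: "3 * r + 3 \<le> n" using True by (simp add: r_def)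
  have E: "?E \<in> graphs_on n" by (intro graph_of_in_graphs_on) (auto simp: P_def)
  have "\<not> contains_cycle a ?E" if a: "a \<in> A" for a
  proof
    assume c: "contains_cycle a ?E"
    have b: "u \<in> {..<3} \<longleftrightarrow> v \<notin> {..<3}" if "{u, v} \<in> ?E" for u v
      using that by (auto simp: graph_of_iff P_def)
    have "even a" "a \<le> 6" using cycle_in_bipartite[OF b c] by auto
    moreover have "3 \<le> a" using assms(1) a by blast
    ultimately have "a = 4 \<or> a = 6" by presburger
    then show False using a assms by blast
  qed
  moreover have "inj_on ?f ?I" by (auto simp: inj_on_def)
  moreover have "?f ` ?I \<subseteq> cyc_lists 6 ?E"
    using r by (auto simp: cyc_lists_6_iff graph_of_iff P_def)
  ultimately have "card ?I \<le> 6 ^ 6 * ex_cycle n 6 A" by (rule card_le_ex_cycle[OF E])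
  moreover have "card ?I = r ^ 3" by (simp add: card_cartesian_product numeral_eq_Suc)
  ultimately show ?thesis by (simp only: r_def)
qed simp

section \<open>The theta graph, with poles 0 and 1 and paths 0, 2 + 2 i, 3 + 2 i, 1\<close>

definition theta_edge :: "nat \<Rightarrow> nat \<Rightarrow> nat \<Rightarrow> bool" where
  "theta_edge m u v \<longleftrightarrow> (\<exists>i<m. (u = 0 \<and> v = 2 + 2 * i) \<or> (u = 2 + 2 * i \<and> v = 3 + 2 * i) \<or> (u = 3 + 2 * i \<and> v = 1))"

lemma theta_nbrs:
  assumes "{u, v} \<in> graph_of (theta_edge m)"
  shows "u = 0 \<Longrightarrow> \<exists>i. v = 2 + 2 * i" "u = 1 \<Longrightarrow> \<exists>i. v = 3 + 2 * i"
    "u = 2 + 2 * i \<Longrightarrow> v = 0 \<or> v = 3 + 2 * i" "u = 3 + 2 * i \<Longrightarrow> v = 1 \<or> v = 2 + 2 * i"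
    "u = 0 \<or> u = 1 \<or> (\<exists>i. u = 2 + 2 * i \<or> u = 3 + 2 * i)"
proof -
  obtain l where l: "u = 0 \<and> v = 2 + 2 * l \<or> v = 0 \<and> u = 2 + 2 * l \<or> u = 2 + 2 * l \<and> v = 3 + 2 * l \<or>
      v = 2 + 2 * l \<and> u = 3 + 2 * l \<or> u = 3 + 2 * l \<and> v = 1 \<or> v = 3 + 2 * l \<and> u = 1"
    using assms unfolding graph_of_iff theta_edge_def by blast
  show "u = 0 \<Longrightarrow> \<exists>i. v = 2 + 2 * i" using l by presburger
  show "u = 1 \<Longrightarrow> \<exists>i. v = 3 + 2 * i" using l by presburger
  show "u = 2 + 2 * i \<Longrightarrow> v = 0 \<or> v = 3 + 2 * i" using l by presburger
  show "u = 3 + 2 * i \<Longrightarrow> v = 1 \<or> v = 2 + 2 * i" using l by presburger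
  show "u = 0 \<or> u = 1 \<or> (\<exists>i. u = 2 + 2 * i \<or> u = 3 + 2 * i)" using l by presburger
qed

text \<open>A cycle cannot turn back, so three steps after one pole it is at the other, and after
  six steps it has returned. Hence \<open>k\<close> divides 6 but not 3.\<close>

lemma cycle_in_theta:
  assumes "contains_cycle k (graph_of (theta_edge m))"
  shows "k = 6"
proof -
  let ?E = "graph_of (theta_edge m)"
  from assms obtain g where "3 \<le> k" "\<forall>i. {g i, g (Suc i)} \<in> ?E" "\<forall>i j. g i = g j \<longleftrightarrow> i mod k = j mod k"
    by (rule contains_cycle_periodic)
  then have g: "3 \<le> k" "\<And>i. {g i, g (Suc i)} \<in> ?E" "\<And>i j. g i = g j \<longleftrightarrow> i mod k = j mod k" by simp_all
  have eq_iff: "g i = g (i + d) \<longleftrightarrow> k dvd d" for i d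
    unfolding g(3) using mod_eq_dvd_iff_nat[of i "i + d" k] by (auto simp: eq_commute)
  have ne2: "g (Suc (Suc i)) \<noteq> g i" for i
    using eq_iff[of i 2] g(1) by (auto dest: dvd_imp_le)
  have A: "g (j + 3) = 1" if gj: "g j = 0" for j
  proof -
    obtain i where i: "g (Suc j) = 2 + 2 * i" using theta_nbrs(1)[OF g(2) gj] by blast
    then have "g (Suc (Suc j)) = 3 + 2 * i" using theta_nbrs(3)[OF g(2) i] ne2[of j] gj by auto
    then have "g (Suc (Suc (Suc j))) = 1" using theta_nbrs(4)[OF g(2), of "Suc (Suc j)"] ne2[of "Suc j"] i by auto
    then show ?thesis by (simp add: eval_nat_numeral)
  qed
  have B: "g (j + 3) = 0" if gj: "g j = 1" for j
  proof -
    obtain i where i: "g (Suc j) = 3 + 2 * i" using theta_nbrs(2)[OF g(2) gj] by blast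
    then have "g (Suc (Suc j)) = 2 + 2 * i" using theta_nbrs(4)[OF g(2) i] ne2[of j] gj by auto
    then have "g (Suc (Suc (Suc j))) = 0" using theta_nbrs(3)[OF g(2), of "Suc (Suc j)"] ne2[of "Suc j"] i by auto
    then show ?thesis by (simp add: eval_nat_numeral)
  qed
  \<comment> \<open>A cycle missing both poles would be confined to the middle edge of one path and
    would have to turn back.\<close>
  have "\<exists>j. g j = 0 \<or> g j = 1"
  proof (rule ccontr)
    assume neg: "\<not> ?thesis"
    then obtain i where "g 0 = 2 + 2 * i \<or> g 0 = 3 + 2 * i" using theta_nbrs(5)[OF g(2)[of 0]] by blast
    then show False
    proof
      assume i: "g 0 = 2 + 2 * i"
      then have "g (Suc 0) = 3 + 2 * i" using theta_nbrs(3)[OF g(2) i] neg by blast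
      then have "g (Suc (Suc 0)) = g 0" using theta_nbrs(4)[OF g(2), of "Suc 0"] neg i by metis
      then show False using ne2 by blast
    next
      assume i: "g 0 = 3 + 2 * i"
      then have "g (Suc 0) = 2 + 2 * i" using theta_nbrs(4)[OF g(2) i] neg by blast
      then have "g (Suc (Suc 0)) = g 0" using theta_nbrs(3)[OF g(2), of "Suc 0"] neg i by metis
      then show False using ne2 by blast
    qed
  qed
  then obtain j where j: "g j = 0 \<or> g j = 1" by blast
  then have "g (j + 3) \<noteq> g j" using A B by auto
  moreover have "g (j + 6) = g j" using j A[of j] B[of j] A[of "j + 3"] B[of "j + 3"] by (auto simp: add.assoc)
  ultimately have "\<not> k dvd 3" "k dvd 6" using eq_iff[of j 3] eq_iff[of j 6] by auto
  then have "k \<le> 6" by (auto dest: dvd_imp_le)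
  then have "k \<in> {3, 4, 5, 6}" using g(1) by auto
  then show "k = 6" using \<open>\<not> k dvd 3\<close> \<open>k dvd 6\<close> by (auto simp: dvd_def) presburger+
qed

lemma ex_cycle_lower_2:
  assumes "6 \<notin> A"
  shows "((n - 2) div 4) ^ 2 \<le> 6 ^ 6 * ex_cycle n 6 A"
proof (cases "2 \<le> n")
  case True
  define r where "r = (n - 2) div 4"
  let ?E = "graph_of (theta_edge (2 * r))"
  \<comment> \<open>One path among the first \<open>r\<close> and one among the last
    \<open>r\<close> form a hexagon.\<close>
  let ?f = "\<lambda>(i, j). [0, 2 + 2 * i, 3 + 2 * i, 1, 3 + 2 * (r + j), 2 + 2 * (r + j)]"
  let ?I = "{..<r} \<times> {..<r}"
  have r: "4 * r + 2 \<le> n" using True by (simp add: r_def)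
  have E: "?E \<in> graphs_on n"
    using r by (intro graph_of_in_graphs_on) (auto simp: theta_edge_def)
  have "\<not> contains_cycle a ?E" if a: "a \<in> A" for a
    using cycle_in_theta a assms by blast
  moreover have "inj_on ?f ?I" by (auto simp: inj_on_def)
  moreover have "?f ` ?I \<subseteq> cyc_lists 6 ?E"
  proof
    fix h assume "h \<in> ?f ` ?I"
    then obtain i j where ij: "i < r" "j < r" "h = ?f (i, j)" by auto
    have "{0, 2 + 2 * l} \<in> ?E" "{2 + 2 * l, 3 + 2 * l} \<in> ?E" "{3 + 2 * l, 1} \<in> ?E" if "l < 2 * r" for l
      using that by (auto simp: graph_of_iff theta_edge_def)
    from this[of i] this[of "r + j"] show "h \<in> cyc_lists 6 ?E"
      using ij unfolding ij(3) prod.case cyc_lists_6_iff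
      by (auto simp: insert_commute)
  qed
  ultimately have "card ?I \<le> 6 ^ 6 * ex_cycle n 6 A" by (rule card_le_ex_cycle[OF E])
  moreover have "card ?I = r ^ 2" by (simp add: card_cartesian_product numeral_eq_Suc)
  ultimately show ?thesis by (simp only: r_def)
qed simp

section \<open>Finite fields of characteristic two\<close>

lemma card_roots_eq_degree:
  fixes p :: "'a :: alg_closed_field poly"
  assumes p: "p \<noteq> 0" and simple: "\<And>x. poly p x = 0 \<Longrightarrow> poly (pderiv p) x \<noteq> 0"
  shows "card {x. poly p x = 0} = degree p"
proof -
  obtain A where A: "size A = degree p" "p = smult (lead_coeff p) (\<Prod>x\<in>#A. [:-x, 1:])"
    using alg_closed_imp_factorization[OF p] by blast
  have root: "poly p x = 0 \<longleftrightarrow> x \<in># A" for x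
    using p by (subst A(2)) (auto simp: poly_prod_mset prod_mset_zero_iff)
  \<comment> \<open>A root of multiplicity at least two would also be a root of the derivative, so
    the multiset of roots is a set.\<close>
  have "count A x \<le> 1" for x
  proof (rule ccontr)
    assume "\<not> count A x \<le> 1"
    then have "{#x, x#} \<subseteq># A" by (simp add: subseteq_mset_def)
    then obtain B where B: "A = {#x, x#} + B" by (metis subset_mset.le_iff_add)
    define q where "q = smult (lead_coeff p) (\<Prod>y\<in>#B. [:-y, 1:])"
    have "p = [:-x, 1:] * ([:-x, 1:] * q)"
      by (subst A(2)) (simp only: B q_def image_mset_union prod_mset.union image_mset_add_mset
          prod_mset.add_mset image_mset_empty prod_mset.empty mult_smult_right mult_smult_left mult_1_right mult.assoc)
    then have "poly p x = 0" "poly (pderiv p) x = 0"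
      by (simp_all add: pderiv_mult del: mult_pCons_left)
    then show False using simple by blast
  qed
  then have "A = mset_set (set_mset A)"
    by (intro multiset_eqI) (auto simp: count_mset_set' not_in_iff intro: antisym)
  then have "size A = card (set_mset A)" by (metis size_mset_set)
  then show ?thesis using root A(1) by (simp add: Collect_mem_eq)
qed

text \<open>
  The roots of \<open>X ^ 2 ^ m - X\<close> provide a finite plane of an order within a factor of two of any given
  number, which replaces the usual appeal to the distribution of primes.
\<close>

lemma ex_finite_subfield:
  assumes "0 < m"
  obtains F :: "bit alg_closure set" where "finite F" "card F = 2 ^ m"
    "\<forall>x\<in>F. \<forall>y\<in>F. x + y \<in> F \<and> x - y \<in> F \<and> x * y \<in> F \<and> x / y \<in> F"
proof -
  let ?q = "2 ^ m :: nat"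
  have "CHAR(bit) = 2" 
  proof (rule CHAR_eq_posI)
    fix x :: nat assume "0 < x" "x < 2"
    then have "x = 1" by simp
    then show "of_nat x \<noteq> (0 :: bit)" by simp
  qed auto
  then have char: "CHAR(bit alg_closure) = 2" by simp
  have q2: "2 \<le> ?q" using assms by (cases m) auto
  have of_q: "of_nat ?q = (0 :: bit alg_closure)"
    unfolding of_nat_eq_0_iff_char_dvd char using assms by simp
  have neg: "- x = x" for x :: "bit alg_closure"
  proof -
    have "of_nat 2 = (0 :: bit alg_closure)" unfolding of_nat_eq_0_iff_char_dvd char by simp
    then have "x + x = 0" by (metis mult_2 mult_zero_left of_nat_numeral)
    then show ?thesis by (simp add: minus_unique)
  qed
  have sub: "x - y = x + y" for x y :: "bit alg_closure"
    by (metis neg diff_conv_add_uminus)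
  \<comment> \<open>The map raising to the power \<open>?q\<close> is additive, so its fixed points
    are closed under addition, and under subtraction since \<open>x - y = x + y\<close>. As it also
    respects products and quotients, they form the required set.\<close>
  have add: "(x + y) ^ ?q = x ^ ?q + y ^ ?q" for x y :: "bit alg_closure"
    by (rule freshmans_dream'[of ?q m]) (simp_all only: char two_is_prime_nat)
  define p :: "bit alg_closure poly" where "p = monom 1 ?q - [:0, 1:]"
  have "degree p = ?q"
  proof -
    have "degree (monom 1 ?q + - [:0, 1 :: bit alg_closure:]) = degree (monom (1 :: bit alg_closure) ?q)"
      using q2 by (intro degree_add_eq_left) (simp add: degree_monom_eq)
    then show ?thesis unfolding p_def diff_conv_add_uminus by (simp only: degree_monom_eq one_neq_zero not_False_eq_True)
  qed
  then have p0: "p \<noteq> 0" using q2 by auto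
  have "pderiv (monom (1 :: bit alg_closure) ?q) = 0"
    by (simp only: pderiv_monom of_q mult_zero_left monom_eq_0)
  \<comment> \<open>The derivative has no zero, so all \<open>?q\<close> roots are simple.\<close>
  then have "pderiv p = - 1"
    by (simp add: p_def pderiv_diff pderiv_pCons one_pCons)
  then have "card {x. poly p x = 0} = degree p" by (intro card_roots_eq_degree p0) simp
  moreover have "{x. poly p x = 0} = {x. x ^ ?q = x}" by (simp add: p_def poly_monom)
  ultimately have card: "card {x :: bit alg_closure. x ^ ?q = x} = ?q" using \<open>degree p = ?q\<close> by simp
  show thesis
  proof (rule that[of "{x. x ^ ?q = x}"])
    show "finite {x :: bit alg_closure. x ^ ?q = x}" using card q2 by (intro card_ge_0_finite) simp
    show "card {x :: bit alg_closure. x ^ ?q = x} = 2 ^ m" by (rule card)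
  qed (simp_all add: add sub power_mult_distrib power_divide)
qed

section \<open>The incidence graph of an affine plane without its vertical lines\<close>

locale affine_plane_graph =
  fixes F :: "'a :: field set" and e :: "'a \<Rightarrow> nat" and q :: nat
  assumes e: "bij_betw e F {..<q}"
    and closed: "\<And>x y. x \<in> F \<Longrightarrow> y \<in> F \<Longrightarrow> x + y \<in> F" "\<And>x y. x \<in> F \<Longrightarrow> y \<in> F \<Longrightarrow> x - y \<in> F"
      "\<And>x y. x \<in> F \<Longrightarrow> y \<in> F \<Longrightarrow> x * y \<in> F" "\<And>x y. x \<in> F \<Longrightarrow> y \<in> F \<Longrightarrow> x / y \<in> F"
begin

text \<open>Base \<open>q\<close> codes: points use the numbers below \<open>q\<^sup>2\<close>, and
  the line with slope \<open>s\<close> and intercept \<open>c\<close> a number in the next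
  \<open>q\<^sup>2\<close>.\<close>

definition pt :: "'a \<Rightarrow> 'a \<Rightarrow> nat" where "pt a b = e a * q + e b"
definition ln :: "'a \<Rightarrow> 'a \<Rightarrow> nat" where "ln s c = q\<^sup>2 + e s * q + e c"

definition incident :: "nat \<Rightarrow> nat \<Rightarrow> bool" where
  "incident u v \<longleftrightarrow> (\<exists>a\<in>F. \<exists>b\<in>F. \<exists>s\<in>F. \<exists>c\<in>F. u = pt a b \<and> v = ln s c \<and> b = s * a + c)"

lemma e_lt: "x \<in> F \<Longrightarrow> e x < q"
  using e by (auto simp: bij_betw_def)

lemma e_inj: "x \<in> F \<Longrightarrow> y \<in> F \<Longrightarrow> e x = e y \<longleftrightarrow> x = y"
  using e by (auto simp: bij_betw_def inj_on_def)

lemma code_inj: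
  assumes "x \<in> F" "y \<in> F" "x' \<in> F" "y' \<in> F"
  shows "e x * q + e y = e x' * q + e y' \<longleftrightarrow> x = x' \<and> y = y'"
proof
  assume eq: "e x * q + e y = e x' * q + e y'"
  have "e x = (e x * q + e y) div q" "e y = (e x * q + e y) mod q" using e_lt[OF assms(2)] by simp_all
  moreover have "e x' = (e x' * q + e y') div q" "e y' = (e x' * q + e y') mod q" using e_lt[OF assms(4)] by simp_all
  ultimately have "e x = e x'" "e y = e y'" using eq by metis+
  then show "x = x' \<and> y = y'" using e_inj assms by blast
qed simp

lemma code_lt: "x \<in> F \<Longrightarrow> y \<in> F \<Longrightarrow> e x * q + e y < q\<^sup>2"
proof -
  assume "x \<in> F" "y \<in> F"
  then have "e x + 1 \<le> q" "e y < q" using e_lt by (auto simp: Suc_le_eq)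
  then have "e x * q + e y < (e x + 1) * q" "(e x + 1) * q \<le> q * q" by (simp, intro mult_le_mono1) auto
  then show ?thesis by (simp add: power2_eq_square)
qed

lemma pt_inj: "a \<in> F \<Longrightarrow> b \<in> F \<Longrightarrow> a' \<in> F \<Longrightarrow> b' \<in> F \<Longrightarrow> pt a b = pt a' b' \<longleftrightarrow> a = a' \<and> b = b'"
  unfolding pt_def by (rule code_inj)

lemma ln_inj: "a \<in> F \<Longrightarrow> b \<in> F \<Longrightarrow> a' \<in> F \<Longrightarrow> b' \<in> F \<Longrightarrow> ln a b = ln a' b' \<longleftrightarrow> a = a' \<and> b = b'"
  unfolding ln_def using code_inj by (simp add: add.assoc)

lemma pt_lt: "a \<in> F \<Longrightarrow> b \<in> F \<Longrightarrow> pt a b < q\<^sup>2"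
  unfolding pt_def by (rule code_lt)

lemma ln_bounds: "a \<in> F \<Longrightarrow> b \<in> F \<Longrightarrow> q\<^sup>2 \<le> ln a b \<and> ln a b < 2 * q\<^sup>2"
  unfolding ln_def using code_lt[of a b] by simp

lemma incident_bounds: "incident u v \<Longrightarrow> u < q\<^sup>2 \<and> q\<^sup>2 \<le> v \<and> v < 2 * q\<^sup>2"
  unfolding incident_def using pt_lt ln_bounds by blast

lemma graph: "2 * q\<^sup>2 \<le> n \<Longrightarrow> graph_of incident \<in> graphs_on n"
  using incident_bounds by (intro graph_of_in_graphs_on) fastforce

lemma bipartite: "{u, v} \<in> graph_of incident \<Longrightarrow> u \<in> {..<q\<^sup>2} \<longleftrightarrow> v \<notin> {..<q\<^sup>2}"
  unfolding graph_of_iff using incident_bounds[of u v] incident_bounds[of v u] by auto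

text \<open>Two points on two common lines: combining the four equations gives
  \<open>(s - s') * (a - a') = 0\<close>. Equal slopes force equal lines, and equal abscissas force
  equal points.\<close>

lemma incident_unique:
  assumes "incident u v" "incident u v'" "incident u' v" "incident u' v'"
  shows "u = u' \<or> v = v'"
proof -
  obtain a b s c where 1: "a \<in> F" "b \<in> F" "s \<in> F" "c \<in> F" "u = pt a b" "v = ln s c" "b = s * a + c"
    using assms(1) unfolding incident_def by blast
  obtain a' b' s' c' where 2: "a' \<in> F" "b' \<in> F" "s' \<in> F" "c' \<in> F" "u' = pt a' b'" "v' = ln s' c'" "b' = s' * a' + c'"
    using assms(4) unfolding incident_def by blast
  have 3: "b = s' * a + c'" using assms(2) 1 2 pt_inj ln_inj unfolding incident_def by metis
  have 4: "b' = s * a' + c" using assms(3) 1 2 pt_inj ln_inj unfolding incident_def by metis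
  have "(s - s') * (a - a') = (s * a + c) - (s' * a + c') - ((s * a' + c) - (s' * a' + c'))"
    by (simp add: algebra_simps)
  also have "\<dots> = 0" using 1(7) 2(7) 3 4 by simp
  finally have "s = s' \<or> a = a'" by simp
  then show ?thesis
  proof
    assume "s = s'"
    then have "c = c'" using 1(7) 3 by (metis add_left_cancel)
    then show ?thesis using 1(6) 2(6) \<open>s = s'\<close> by simp
  next
    assume "a = a'"
    then have "b = b'" using 1(7) 4 by metis
    then show ?thesis using 1(5) 2(5) \<open>a = a'\<close> by simp
  qed
qed

lemma C4_free: "\<not> contains_cycle 4 (graph_of incident)"
proof
  assume "contains_cycle 4 (graph_of incident)"
  then obtain h where h: "h \<in> cyc_lists 4 (graph_of incident)" by (auto simp: contains_cycle_iff)
  then have "length h = 4" by (simp add: cyc_lists_def)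
  then obtain u v w x where hh: "h = [u, v, w, x]" unfolding length_4_conv by blast
  have c: "u \<noteq> w" "v \<noteq> x" "{u, v} \<in> graph_of incident" "{v, w} \<in> graph_of incident"
      "{w, x} \<in> graph_of incident" "{x, u} \<in> graph_of incident"
    using h unfolding hh cyc_lists_4_iff by auto
  note b = bipartite[OF c(3)] bipartite[OF c(4)] bipartite[OF c(5)] bipartite[OF c(6)]
  show False
  proof (cases "u < q\<^sup>2")
    case True
    then have "incident u v" "incident w v" "incident w x" "incident u x"
      using b c(3-6) incident_bounds unfolding graph_of_iff by (metis lessThan_iff linorder_not_le)+
    then show False using incident_unique c(1,2) by blast
  next
    case False
    then have "incident v u" "incident v w" "incident x w" "incident x u"
      using b c(3-6) incident_bounds unfolding graph_of_iff by (metis lessThan_iff linorder_not_le)+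
    then show False using incident_unique c(1,2) by blast
  qed
qed

text \<open>A hexagon is a triangle of three points and three lines. The second and third point lie
  on the lines of slopes \<open>s1\<close> and \<open>s2\<close> through the first, and
  \<open>s3\<close> is the slope of the line joining them.\<close>

lemma hexagon:
  assumes F: "a1 \<in> F" "a2 \<in> F" "a3 \<in> F" "s1 \<in> F" "s2 \<in> F" "b1 \<in> F"
    and ne: "a1 \<noteq> a2" "a1 \<noteq> a3" "a2 \<noteq> a3" "s1 \<noteq> s2"
  defines "b2 \<equiv> b1 + s1 * (a2 - a1)" and "b3 \<equiv> b1 + s2 * (a3 - a1)"
  defines "s3 \<equiv> (b3 - b2) / (a3 - a2)"
  shows "[pt a1 b1, ln s1 (b1 - s1 * a1), pt a2 b2, ln s3 (b2 - s3 * a2), pt a3 b3, ln s2 (b1 - s2 * a1)]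
    \<in> cyc_lists 6 (graph_of incident)"
proof -
  have F': "b2 \<in> F" "b3 \<in> F" "s3 \<in> F" unfolding s3_def b2_def b3_def by (intro closed F)+
  have Fc: "b1 - s1 * a1 \<in> F" "b2 - s3 * a2 \<in> F" "b1 - s2 * a1 \<in> F" by (intro closed F F')+
  have s3: "s3 * (a3 - a2) = b3 - b2" using ne by (simp add: s3_def)
  have inc: "{pt a b, ln s c} \<in> graph_of incident" if "a \<in> F" "b \<in> F" "s \<in> F" "c \<in> F" "b = s * a + c" for a b s c
    using that unfolding graph_of_iff incident_def by blast
  have ptln: "pt a b \<noteq> ln s c" if "a \<in> F" "b \<in> F" "s \<in> F" "c \<in> F" for a b s c
    using pt_lt[OF that(1,2)] ln_bounds[OF that(3,4)] by auto
  \<comment> \<open>If the third side coincided with one of the others, the three points would be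
    collinear and \<open>s1 = s2\<close>.\<close>
  have l13: "\<not> (s1 = s3 \<and> b1 - s1 * a1 = b2 - s3 * a2)"
  proof
    assume "s1 = s3 \<and> b1 - s1 * a1 = b2 - s3 * a2"
    then have "s1 * (a3 - a2) = b3 - b2" using s3 by simp
    then have "(s1 - s2) * (a3 - a1) = 0" unfolding b2_def b3_def by (simp add: algebra_simps)
    then show False using ne by auto
  qed
  have l23: "\<not> (s2 = s3 \<and> b1 - s2 * a1 = b2 - s3 * a2)"
  proof
    assume "s2 = s3 \<and> b1 - s2 * a1 = b2 - s3 * a2"
    then have "b1 - s2 * a1 = b2 - s2 * a2" by metis
    then have "(s1 - s2) * (a2 - a1) = 0" unfolding b2_def by (simp add: algebra_simps)
    then show False using ne by auto
  qed
  have "{pt a1 b1, ln s1 (b1 - s1 * a1)} \<in> graph_of incident"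
    by (intro inc F Fc) simp
  moreover have "{pt a2 b2, ln s1 (b1 - s1 * a1)} \<in> graph_of incident"
    by (intro inc F F' Fc) (simp add: b2_def algebra_simps)
  moreover have "{pt a2 b2, ln s3 (b2 - s3 * a2)} \<in> graph_of incident"
    by (intro inc F F' Fc) simp
  moreover have "{pt a3 b3, ln s3 (b2 - s3 * a2)} \<in> graph_of incident"
    using s3 by (intro inc F F' Fc) (simp add: algebra_simps)
  moreover have "{pt a3 b3, ln s2 (b1 - s2 * a1)} \<in> graph_of incident"
    by (intro inc F F' Fc) (simp add: b3_def algebra_simps)
  moreover have "{pt a1 b1, ln s2 (b1 - s2 * a1)} \<in> graph_of incident"
    by (intro inc F F' Fc) simp
  moreover have "pt a1 b1 \<noteq> pt a2 b2" "pt a1 b1 \<noteq> pt a3 b3" "pt a2 b2 \<noteq> pt a3 b3"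
    using pt_inj F F' ne by auto
  moreover have "ln s1 (b1 - s1 * a1) \<noteq> ln s2 (b1 - s2 * a1)" using ln_inj F Fc ne by auto
  moreover have "ln s1 (b1 - s1 * a1) \<noteq> ln s3 (b2 - s3 * a2)" using ln_inj F(4) F'(3) Fc l13 by blast
  moreover have "ln s2 (b1 - s2 * a1) \<noteq> ln s3 (b2 - s3 * a2)" using ln_inj F(5) F'(3) Fc l23 by blast
  ultimately show ?thesis
    using ptln ptln[THEN not_sym] F F' Fc unfolding cyc_lists_6_iff by (auto simp: insert_commute)
qed

text \<open>Triangles have six free parameters: three abscissas, two slopes and one ordinate.
  Choosing them from disjoint blocks of \<open>q div 3\<close> field elements keeps the abscissas
  distinct and the slopes distinct.\<close>

lemma ex_cycle_lower:
  assumes n: "2 * q\<^sup>2 \<le> n" and A: "\<And>a. a \<in> A \<Longrightarrow> even a \<Longrightarrow> a = 4"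
  shows "(q div 3) ^ 6 \<le> 6 ^ 6 * ex_cycle n 6 A"
proof -
  define r where "r = q div 3"
  define B where "B j = {x \<in> F. j * r \<le> e x \<and> e x < (j + 1) * r}" for j
  have cardB: "card (B j) = r" if "j < 3" for j
  proof -
    have "e ` B j = {j * r..<(j + 1) * r}"
    proof
      show "{j * r..<(j + 1) * r} \<subseteq> e ` B j"
      proof
        fix i assume i: "i \<in> {j * r..<(j + 1) * r}"
        have "(j + 1) * r \<le> 3 * r" using that by (intro mult_le_mono1) auto
        moreover have "3 * r \<le> q" by (simp add: r_def)
        ultimately have "i < q" using i unfolding atLeastLessThan_iff by linarith
        then have "i \<in> e ` F" using e by (simp add: bij_betw_def)
        then obtain x where "x \<in> F" "i = e x" by blast
        then show "i \<in> e ` B j" using i by (auto simp: B_def)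
      qed
    qed (auto simp: B_def)
    moreover have "inj_on e (B j)" using e_inj by (auto simp: inj_on_def B_def)
    ultimately have "card (B j) = card {j * r..<(j + 1) * r}" by (metis card_image)
    then show ?thesis by simp
  qed
  have BF: "x \<in> F" if "x \<in> B j" for x j using that by (simp add: B_def)
  have dis: "x \<noteq> y" if "x \<in> B i" "y \<in> B j" "i < j" for x y i j
  proof
    assume "x = y"
    then have "j * r < (i + 1) * r" using that by (auto simp: B_def)
    moreover have "(i + 1) * r \<le> j * r" using that by (intro mult_le_mono1) auto
    ultimately show False by simp
  qed
  let ?I = "B 0 \<times> B 1 \<times> B 2 \<times> B 0 \<times> B 1 \<times> B 0"
  let ?f = "\<lambda>(a1, a2, a3, s1, s2, b1).
    (let b2 = b1 + s1 * (a2 - a1); b3 = b1 + s2 * (a3 - a1); s3 = (b3 - b2) / (a3 - a2)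
     in [pt a1 b1, ln s1 (b1 - s1 * a1), pt a2 b2, ln s3 (b2 - s3 * a2), pt a3 b3, ln s2 (b1 - s2 * a1)])"
  have "\<not> contains_cycle a (graph_of incident)" if a: "a \<in> A" for a
  proof
    assume c: "contains_cycle a (graph_of incident)"
    then have "even a" using cycle_in_bipartite(1)[OF bipartite] by blast
    then show False using A a c C4_free by blast
  qed
  \<comment> \<open>The parameters can be read off the three points and the two lines through the
    first one.\<close>
  moreover have "inj_on ?f ?I"
  proof (rule inj_onI)
    fix x y assume x: "x \<in> ?I" and y: "y \<in> ?I" and eq: "?f x = ?f y"
    obtain a1 a2 a3 s1 s2 b1 where xx: "x = (a1, a2, a3, s1, s2, b1)" by (cases x)
    obtain a1' a2' a3' s1' s2' b1' where yy: "y = (a1', a2', a3', s1', s2', b1')" by (cases y)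
    have Fx: "a1 \<in> F" "a2 \<in> F" "a3 \<in> F" "s1 \<in> F" "s2 \<in> F" "b1 \<in> F" using x BF unfolding xx by blast+
    have Fy: "a1' \<in> F" "a2' \<in> F" "a3' \<in> F" "s1' \<in> F" "s2' \<in> F" "b1' \<in> F" using y BF unfolding yy by blast+
    have Gx: "b1 + s1 * (a2 - a1) \<in> F" "b1 + s2 * (a3 - a1) \<in> F" "b1 - s1 * a1 \<in> F" "b1 - s2 * a1 \<in> F"
      by (intro closed Fx)+
    have Gy: "b1' + s1' * (a2' - a1') \<in> F" "b1' + s2' * (a3' - a1') \<in> F" "b1' - s1' * a1' \<in> F" "b1' - s2' * a1' \<in> F"
      by (intro closed Fy)+
    have E: "pt a1 b1 = pt a1' b1'" "ln s1 (b1 - s1 * a1) = ln s1' (b1' - s1' * a1')"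
      "pt a2 (b1 + s1 * (a2 - a1)) = pt a2' (b1' + s1' * (a2' - a1'))"
      "pt a3 (b1 + s2 * (a3 - a1)) = pt a3' (b1' + s2' * (a3' - a1'))"
      "ln s2 (b1 - s2 * a1) = ln s2' (b1' - s2' * a1')"
      using eq unfolding xx yy prod.case Let_def by simp_all
    have "a1 = a1' \<and> b1 = b1'" using E(1) pt_inj Fx Fy by blast
    moreover have "s1 = s1'" using E(2) ln_inj Fx(4) Fy(4) Gx(3) Gy(3) by blast
    moreover have "a2 = a2'" using E(3) pt_inj Fx(2) Fy(2) Gx(1) Gy(1) by blast
    moreover have "a3 = a3'" using E(4) pt_inj Fx(3) Fy(3) Gx(2) Gy(2) by blast
    moreover have "s2 = s2'" using E(5) ln_inj Fx(5) Fy(5) Gx(4) Gy(4) by blast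
    ultimately show "x = y" by (simp add: xx yy)
  qed
  moreover have "?f ` ?I \<subseteq> cyc_lists 6 (graph_of incident)"
  proof
    fix h assume "h \<in> ?f ` ?I"
    then obtain x where x: "x \<in> ?I" "h = ?f x" by blast
    obtain a1 a2 a3 s1 s2 b1 where xx: "x = (a1, a2, a3, s1, s2, b1)" by (cases x)
    have m: "a1 \<in> B 0" "a2 \<in> B 1" "a3 \<in> B 2" "s1 \<in> B 0" "s2 \<in> B 1" "b1 \<in> B 0" using x(1) unfolding xx by blast+
    show "h \<in> cyc_lists 6 (graph_of incident)"
      unfolding x(2) xx prod.case Let_def
      by (rule hexagon[OF BF BF BF BF BF BF dis dis dis dis]) (rule m | simp)+
  qed
  ultimately have "card ?I \<le> 6 ^ 6 * ex_cycle n 6 A" by (rule card_le_ex_cycle[OF graph[OF n]])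
  moreover have "card ?I = r ^ 6" by (simp add: card_cartesian_product cardB numeral_eq_Suc)
  ultimately show ?thesis by (simp only: r_def)
qed

end

text \<open>Take the largest power \<open>q\<close> of two with \<open>2 * q\<^sup>2 <= n\<close>,
  so that \<open>n < 8 * q\<^sup>2\<close>. From \<open>32 <= n\<close> follows
  \<open>4 <= q\<close>, hence \<open>q <= 5 * (q div 3)\<close>, and 200 is 8 times 25.\<close>

lemma ex_cycle_lower_C4_free:
  assumes A: "\<And>a. a \<in> A \<Longrightarrow> even a \<Longrightarrow> a = 4" and n: "32 \<le> n"
  shows "n ^ 3 \<le> 200 ^ 3 * (6 ^ 6 * ex_cycle n 6 A)"
proof -
  have "1 \<le> n div 2" using n by simp
  then obtain m where m: "4 ^ m \<le> n div 2" "n div 2 < 4 ^ (m + 1)"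
    using ex_power_ivl1[of 4 "n div 2"] by auto
  have "(4 :: nat) ^ 2 < 4 ^ (m + 1)" using m(2) n by simp
  then have m2: "2 \<le> m" by (subst (asm) power_strict_increasing_iff) auto
  define q :: nat where "q = 2 ^ m"
  have "q\<^sup>2 = (2\<^sup>2) ^ m" unfolding q_def by (simp only: power_mult[symmetric] mult.commute)
  then have q2: "q\<^sup>2 = 4 ^ m" by simp
  obtain F :: "bit alg_closure set" where F: "finite F" "card F = 2 ^ m"
    "\<forall>x\<in>F. \<forall>y\<in>F. x + y \<in> F \<and> x - y \<in> F \<and> x * y \<in> F \<and> x / y \<in> F"
    by (rule ex_finite_subfield[of m]) (use m2 in simp)
  have "\<exists>e. bij_betw e F {..<q}"
    using ex_bij_betw_finite_nat[OF F(1)] unfolding F(2) q_def lessThan_atLeast0 .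
  then obtain e where "bij_betw e F {..<q}" by blast
  then interpret affine_plane_graph F e q by unfold_locales (use F(3) in blast)+
  have lower: "(q div 3) ^ 6 \<le> 6 ^ 6 * ex_cycle n 6 A"
    using m(1) q2 by (intro ex_cycle_lower A) auto
  have "(2 :: nat) ^ 2 \<le> q" unfolding q_def using m2 by (intro power_increasing) auto
  then have "q \<le> 5 * (q div 3)" by simp
  have "n \<le> 8 * q\<^sup>2" using m(2) q2 by simp
  also have "\<dots> \<le> 8 * (5 * (q div 3))\<^sup>2"
    using \<open>q \<le> 5 * (q div 3)\<close> by (intro mult_le_mono2 power_mono) auto
  also have "\<dots> = 200 * (q div 3)\<^sup>2" by (simp add: power_mult_distrib)
  finally have "n ^ 3 \<le> (200 * (q div 3)\<^sup>2) ^ 3" by (rule power_mono) simp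
  also have "\<dots> = 200 ^ 3 * (q div 3) ^ 6"
    by (simp only: power_mult_distrib power_mult[symmetric]) simp
  also have "\<dots> \<le> 200 ^ 3 * (6 ^ 6 * ex_cycle n 6 A)" by (rule mult_le_mono2[OF lower])
  finally show ?thesis .
qed

section \<open>Orders of magnitude\<close>

text \<open>Once the quotient is at least 1, both \<open>c\<close> and the remainder are absorbed
  into multiples of it. This yields the factors 10, 9 and 12 of the final lower bounds.\<close>

lemma le_mult_div:
  fixes n c d :: nat
  assumes "0 < d" "c + d \<le> n"
  shows "n \<le> (c + 2 * d) * ((n - c) div d)"
proof -
  define r where "r = (n - c) div d"
  have "n - c < d + d * r" unfolding r_def by (rule dividend_less_times_div[OF assms(1)])
  moreover have "0 < r" unfolding r_def using assms by (simp add: div_greater_zero_iff)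
  then have "c \<le> c * r" "d \<le> d * r" by simp_all
  ultimately have "n \<le> c * r + d * r + d * r" using assms(2) by linarith
  then show ?thesis unfolding r_def[symmetric] by (simp add: algebra_simps)
qed

lemma bigtheta_powerI:
  fixes f :: "nat \<Rightarrow> nat"
  assumes up: "\<And>n. f n \<le> C * n ^ d" and low: "\<And>n. N \<le> n \<Longrightarrow> n ^ d \<le> K * f n"
  shows "(\<lambda>n. real (f n)) \<in> \<Theta>(\<lambda>n. real n ^ d)"
proof (rule bigthetaI)
  have "real (f n) \<le> real C * real n ^ d" for n
    using up[of n] by (metis of_nat_le_iff of_nat_mult of_nat_power)
  then show "(\<lambda>n. real (f n)) \<in> O(\<lambda>n. real n ^ d)"
    by (intro bigoI[of _ "real C"] always_eventually) auto
  have "real n ^ d \<le> real K * real (f n)" if "N \<le> n" for n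
    using low[OF that] by (metis of_nat_le_iff of_nat_mult of_nat_power)
  then have "(\<lambda>n. real n ^ d) \<in> O(\<lambda>n. real (f n))"
    by (intro bigoI[of _ "real K"] eventually_sequentiallyI[of N]) auto
  then show "(\<lambda>n. real (f n)) \<in> \<Omega>(\<lambda>n. real n ^ d)"
    by (simp add: bigomega_iff_bigo)
qed

lemma power_le_of_block_bound:
  fixes n r s c x d :: nat
  assumes "r ^ d \<le> c * x" "n \<le> s * r"
  shows "n ^ d \<le> (s ^ d * c) * x"
proof -
  have "n ^ d \<le> (s * r) ^ d" using assms(2) by (intro power_mono) auto
  also have "\<dots> = s ^ d * r ^ d" by (rule power_mult_distrib)
  also have "\<dots> \<le> s ^ d * (c * x)" using assms(1) by (rule mult_le_mono2)
  finally show ?thesis by (simp add: mult.assoc)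
qed

theorem theorem16:
  fixes A :: "nat set"
  assumes "\<forall>a\<in>A. 3 \<le> a"
  defines "Ae \<equiv> {a \<in> A. even a}"
  shows "(6 \<in> A \<longrightarrow> (\<forall>n. ex_cycle n 6 A = 0))
    \<and> (6 \<notin> A \<and> 4 \<in> A \<and> (\<exists>a b. a \<in> Ae \<and> b \<in> Ae \<and> a \<noteq> b) \<longrightarrow>
         (\<lambda>n. real (ex_cycle n 6 A)) \<in> \<Theta>(\<lambda>n. real n ^ 2))
    \<and> ((4 \<notin> A \<and> 6 \<notin> A \<and> Ae \<noteq> {}) \<or> Ae = {4} \<longrightarrow>
         (\<lambda>n. real (ex_cycle n 6 A)) \<in> \<Theta>(\<lambda>n. real n ^ 3))
    \<and> (Ae = {} \<longrightarrow> (\<lambda>n. real (ex_cycle n 6 A)) \<in> \<Theta>(\<lambda>n. real n ^ 6))"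
proof (intro conjI impI)
  have upper: "ex_cycle n 6 A \<le> B"
    if "\<And>E. E \<in> graphs_on n \<Longrightarrow> \<forall>a\<in>A. \<not> contains_cycle a E \<Longrightarrow> card (cyc_lists 6 E) \<le> B" for n B
  proof (rule ex_cycle_le)
    fix E assume E: "E \<in> graphs_on n" "\<forall>a\<in>A. \<not> contains_cycle a E"
    show "num_cycles 6 E \<le> B" using num_cycles_le[OF E(1), of 6] that[OF E] by simp
  qed
  \<comment> \<open>An even element of \<open>A\<close> other than 4 and 6 is at least 8, which puts
    its half in the range of both upper bounds.\<close>
  have long_even: "\<exists>k\<ge>4. 2 * k \<in> A" if "a \<in> Ae" "a \<noteq> 4" "6 \<notin> A" for a
  proof -
    have a: "a \<in> A" "even a" using that(1) by (auto simp: Ae_def)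
    then have "3 \<le> a" "a \<noteq> 6" using assms(1) that(3) by auto
    then have "8 \<le> a" using a(2) that(2) by presburger
    then show ?thesis using a by (intro exI[of _ "a div 2"]) auto
  qed
  {
    assume "6 \<in> A"
    show "\<forall>n. ex_cycle n 6 A = 0"
    proof
      fix n
      have "ex_cycle n 6 A \<le> 0"
        by (rule upper) (use \<open>6 \<in> A\<close> in \<open>auto simp: contains_cycle_iff\<close>)
      then show "ex_cycle n 6 A = 0" by simp
    qed
  next
    assume h: "6 \<notin> A \<and> 4 \<in> A \<and> (\<exists>a b. a \<in> Ae \<and> b \<in> Ae \<and> a \<noteq> b)"
    then obtain a where "a \<in> Ae" "a \<noteq> 4" by metis
    then obtain k where k: "4 \<le> k" "2 * k \<in> A" using long_even h by blast
    show "(\<lambda>n. real (ex_cycle n 6 A)) \<in> \<Theta>(\<lambda>n. real n ^ 2)"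
    proof (rule bigtheta_powerI)
      show "ex_cycle n 6 A \<le> (3 * (4 * k + 4)\<^sup>2 + 12 * (2 * k + 4 * k\<^sup>2)) * n ^ 2" for n
        by (rule upper, rule card_C6_lists_le_if_C4_even_cycle_free) (use h k in auto)
      show "n ^ 2 \<le> (10 ^ 2 * 6 ^ 6) * ex_cycle n 6 A" if "6 \<le> n" for n
      proof (rule power_le_of_block_bound)
        show "((n - 2) div 4) ^ 2 \<le> 6 ^ 6 * ex_cycle n 6 A" using h by (intro ex_cycle_lower_2) blast
        show "n \<le> 10 * ((n - 2) div 4)" using le_mult_div[of 4 2 n] that by simp
      qed
    qed
  next
    assume h: "(4 \<notin> A \<and> 6 \<notin> A \<and> Ae \<noteq> {}) \<or> Ae = {4}"
    show "(\<lambda>n. real (ex_cycle n 6 A)) \<in> \<Theta>(\<lambda>n. real n ^ 3)"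
    proof (cases "Ae = {4}")
      case True
      then have A: "4 \<in> A" "\<And>a. a \<in> A \<Longrightarrow> even a \<Longrightarrow> a = 4" by (auto simp: Ae_def)
      show ?thesis
      proof (rule bigtheta_powerI)
        show "ex_cycle n 6 A \<le> 1 * n ^ 3" for n
          unfolding mult_1 by (rule upper, rule card_C6_lists_le_if_C4_free) (use A(1) in auto)
        show "n ^ 3 \<le> (200 ^ 3 * 6 ^ 6) * ex_cycle n 6 A" if "32 \<le> n" for n
          using ex_cycle_lower_C4_free[OF A(2) that] by (simp only: mult.assoc)
      qed
    next
      case False
      then have A: "4 \<notin> A" "6 \<notin> A" "Ae \<noteq> {}" using h by auto
      then obtain a where "a \<in> Ae" "a \<noteq> 4" by (auto simp: Ae_def)
      then obtain k where k: "4 \<le> k" "2 * k \<in> A" using long_even A by blast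
      show ?thesis
      proof (rule bigtheta_powerI)
        show "ex_cycle n 6 A \<le> (176 * k ^ 3) * n ^ 3" for n
          by (rule upper, rule card_C6_lists_le_if_even_cycle_free) (use k in auto)
        show "n ^ 3 \<le> (9 ^ 3 * 6 ^ 6) * ex_cycle n 6 A" if "6 \<le> n" for n
        proof (rule power_le_of_block_bound)
          show "((n - 3) div 3) ^ 3 \<le> 6 ^ 6 * ex_cycle n 6 A"
            using A(1,2) assms(1) by (intro ex_cycle_lower_3) blast+
          show "n \<le> 9 * ((n - 3) div 3)" using le_mult_div[of 3 3 n] that by simp
        qed
      qed
    qed
  next
    assume "Ae = {}"
    then have A: "\<And>a. a \<in> A \<Longrightarrow> odd a" by (auto simp: Ae_def)
    show "(\<lambda>n. real (ex_cycle n 6 A)) \<in> \<Theta>(\<lambda>n. real n ^ 6)"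
    proof (rule bigtheta_powerI)
      show "ex_cycle n 6 A \<le> 1 * n ^ 6" for n
        unfolding mult_1 by (rule upper, rule card_cyc_lists_le) auto
      show "n ^ 6 \<le> (12 ^ 6 * 6 ^ 6) * ex_cycle n 6 A" if "6 \<le> n" for n
      proof (rule power_le_of_block_bound)
        show "(n div 6) ^ 6 \<le> 6 ^ 6 * ex_cycle n 6 A" by (rule ex_cycle_lower_6[OF A])
        show "n \<le> 12 * (n div 6)" using le_mult_div[of 6 0 n] that by simp
      qed
    qed
  }
qed

end
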